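(* Let $i,j$ be real numbers with $0<j\le i<1$ and $i+j=1$. Let $a,b\in\mathbb{R}$ and $f(x)=ax+b$. Suppose there exists $\epsilon>0$ such that $$\liminf_{q\to\infty} q^{\frac{1}{j}-\epsilon}\max\{\|qa\|,\|qb\|\}>0.$$ Then the set $\mathrm{Bad}^f(i,j):=\{x\in\mathbb{R}:(x,ax+b)\in\mathrm{Bad}(i,j)\}$ is a $1/2$-winning subset of $\mathbb{R}$. Moreover, if $a\in\mathbb{Q}$, the same conclusion holds when the displayed condition is assumed with $\epsilon=0$.
   Context: For $t\in\mathbb{R}$, $\|t\|$ denotes the distance from $t$ to the nearest integer. $\mathrm{Bad}(i,j)$ is the set of $(x,y)\in\mathbb{R}^2$ for which there is $c(x,y)>0$ with $\max\{\|qx\|^{1/i},\|qy\|^{1/j}\}>c(x,y)\,q^{-1}$ for all $q\in\mathbb{N}$. Schmidt's $(\alpha,\beta)$-game on $\mathbb{R}$: for $0<\alpha,\beta<1$, player B chooses a closed interval $B_0$; then A chooses a closed interval $A_0\subset B_0$ of length $\alpha|B_0|$; then B chooses a closed interval $B_1\subset A_0$ of length $\beta|A_0|$, and so on alternately. A set $X\subset\mathbb{R}$ is $(\alpha,\beta)$-winning if A can play so that the unique point of $\bigcap_n B_n$ lies in $X$ regardless of how B plays; it is $\alpha$-winning if it is $(\alpha,\beta)$-winning for every $\beta\in(0,1)$. *)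

theory Defs
  imports "HOL-Analysis.Analysis"
begin

definition dist_int :: "real \<Rightarrow> real" where
  "dist_int t = infdist t \<int>"

definition Bad :: "real \<Rightarrow> real \<Rightarrow> (real \<times> real) set" where
  "Bad i j = {(x, y). \<exists>c>0. \<forall>q::nat. q \<ge> 1 \<longrightarrow>
     max (dist_int (real q * x) powr (1 / i)) (dist_int (real q * y) powr (1 / j)) > c / real q}"

definition Bad_on :: "(real \<Rightarrow> real) \<Rightarrow> real \<Rightarrow> real \<Rightarrow> real set" where
  "Bad_on f i j = {x. (x, f x) \<in> Bad i j}"

text \<open>The intervals of the game are nondegenerate.\<close>

definition closed_interval :: "real set \<Rightarrow> bool" where
  "closed_interval I \<longleftrightarrow> (\<exists>u v. u < v \<and> I = {u..v})"

definition legal_move :: "real \<Rightarrow> real set \<Rightarrow> real set \<Rightarrow> bool" where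
  "legal_move \<gamma> I J \<longleftrightarrow>
     closed_interval J \<and> J \<subseteq> I \<and> measure lborel J = \<gamma> * measure lborel I"

text \<open>A strategy of player A maps the list of B's moves so far to A's answer.\<close>

definition reply :: "(real set list \<Rightarrow> real set) \<Rightarrow> (nat \<Rightarrow> real set) \<Rightarrow> nat \<Rightarrow> real set" where
  "reply \<sigma> B n = \<sigma> (map B [0..<Suc n])"

definition legal_upto ::
  "real \<Rightarrow> (real set list \<Rightarrow> real set) \<Rightarrow> (nat \<Rightarrow> real set) \<Rightarrow> nat \<Rightarrow> bool" where
  "legal_upto \<beta> \<sigma> B n \<longleftrightarrow>
     closed_interval (B 0) \<and> (\<forall>k<n. legal_move \<beta> (reply \<sigma> B k) (B (Suc k)))"

text \<open>
  Legality of A's answers is demanded after every finite legal sequence of moves of B, so that A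
  cannot win by an illegal move after which B has no legal continuation.
\<close>

definition winning2 :: "real \<Rightarrow> real \<Rightarrow> real set \<Rightarrow> bool" where
  "winning2 \<alpha> \<beta> X \<longleftrightarrow> (\<exists>\<sigma>. \<forall>B.
     (\<forall>n. legal_upto \<beta> \<sigma> B n \<longrightarrow> legal_move \<alpha> (B n) (reply \<sigma> B n)) \<and>
     ((\<forall>n. legal_upto \<beta> \<sigma> B n) \<longrightarrow> (\<exists>x\<in>X. (\<Inter>n. B n) = {x})))"

definition winning :: "real \<Rightarrow> real set \<Rightarrow> bool" where
  "winning \<alpha> X \<longleftrightarrow> (\<forall>\<beta>. 0 < \<beta> \<and> \<beta> < 1 \<longrightarrow> winning2 \<alpha> \<beta> X)"

end

theory Submission
  imports Defs
begin

text \<open>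
  Two families of obstacles are avoided: neighbourhoods of the parameters of rational points
  \<open>(p/q, r/q)\<close> close to the line \<open>y = a x + b\<close>, and neighbourhoods of the parameters where rational
  lines \<open>A x + B y + C = 0\<close> cross it. Avoiding the points is what \<open>Bad\<close> asks for. The two families
  control each other: two distinct points of comparable denominator over a short interval span a
  rational line of small height that passes close by, and two distinct lines of comparable height and
  slope meet in a rational point of small denominator that lies close by. Both are obstacles of larger
  size, hence already avoided. So in each class at most one obstacle has to be treated at a time. The
  Diophantine condition on \<open>(a, b)\<close> keeps the slopes \<open>A + a B\<close> from being too small, that is, the
  line obstacles from being too long.

  Player A answers every move by the left or the right half of the interval, whichever contains fewer
  end points of the pending obstacles, counted with weights. This halves the weighted count in every
  round, which beats the growth \<open>3/2\<close> of the weights; an obstacle is gone when its weight reaches 1.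
\<close>

section \<open>A strategy for the game with parameter one half\<close>

text \<open>
  An open interval \<open>(p, q)\<close> that meets \<open>[l, r]\<close> and is not longer than it has an end counted here. The
  half-open conventions make the count additive when \<open>[l, r]\<close> is cut in two.
\<close>

definition ends_in :: "real \<Rightarrow> real \<Rightarrow> real \<Rightarrow> real \<Rightarrow> real" where
  "ends_in p q l r = of_bool (l \<le> p \<and> p < r) + of_bool (l < q \<and> q \<le> r)"

lemma ends_in_nonneg: "0 \<le> ends_in p q l r"
  by (simp add: ends_in_def)

lemma ends_in_le_2: "ends_in p q l r \<le> 2"
  by (simp add: ends_in_def of_bool_def)

lemma ends_in_split:
  assumes "l \<le> m" "m \<le> r"
  shows "ends_in p q l r = ends_in p q l m + ends_in p q m r"
  using assms by (auto simp: ends_in_def of_bool_def)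

lemma ends_in_mono:
  assumes "l \<le> l'" "r' \<le> r"
  shows "ends_in p q l' r' \<le> ends_in p q l r"
  using assms by (auto simp: ends_in_def of_bool_def)

lemma disjoint_if_ends_in_less_1:
  assumes "ends_in p q l r < 1" "q - p \<le> r - l"
  shows "{p<..<q} \<inter> {l..r} = {}"
  using assms by (auto simp: ends_in_def of_bool_def split: if_splits)

section \<open>Legal moves and the halving strategy\<close>

lemma legal_move_Icc:
  assumes "legal_move \<gamma> {x..y} J" "x \<le> y"
  obtains x' y' where "J = {x'..y'}" "x' < y'" "x \<le> x'" "y' \<le> y" "y' - x' = \<gamma> * (y - x)"
  using assms unfolding legal_move_def closed_interval_def by fastforce

lemma legal_upto_Suc:
  "legal_upto \<beta> \<sigma> B (Suc n) \<longleftrightarrow>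
     legal_upto \<beta> \<sigma> B n \<and> legal_move \<beta> (reply \<sigma> B n) (B (Suc n))"
  unfolding legal_upto_def by (auto simp: less_Suc_eq)

text \<open>
  \<open>Ob n \<kappa>\<close> is first taken into account when the interval of round \<open>n\<close> is known, and has to be avoided
  by round \<open>n + d \<kappa>\<close>.
\<close>

lemma halving_strategy_from:
  fixes Ob :: "nat \<Rightarrow> nat \<Rightarrow> real set" and d g :: "nat \<Rightarrow> nat"
  assumes \<beta>: "0 < \<beta>" "\<beta> < 1" and uv: "u < v"
    and weight: "\<And>n. (\<Sum>\<kappa>\<le>g n. 2 * (2/3) ^ d \<kappa>) \<le> (1/5 :: real)"
    and d_pos: "\<And>\<kappa>. 1 \<le> d \<kappa>"
    and single: "\<And>n \<kappa> x y. \<kappa> \<le> g n \<Longrightarrow> {x..y} \<subseteq> {u..v} \<Longrightarrow>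
        y - x = (v - u) * (\<beta>/2) ^ n \<Longrightarrow>
        (\<And>n' \<kappa>'. \<kappa>' \<le> g n' \<Longrightarrow> n' + d \<kappa>' \<le> n \<Longrightarrow> Ob n' \<kappa>' \<inter> {x..y} = {}) \<Longrightarrow>
        \<exists>p q. Ob n \<kappa> \<inter> {x..y} \<subseteq> {p<..<q} \<and> q - p \<le> (v - u) * (\<beta>/2) ^ (n + d \<kappa>)"
    and target: "\<And>x. x \<in> {u..v} \<Longrightarrow> (\<And>n \<kappa>. \<kappa> \<le> g n \<Longrightarrow> x \<notin> Ob n \<kappa>) \<Longrightarrow> x \<in> X"
  shows "\<exists>\<sigma>. \<forall>B. B 0 = {u..v} \<longrightarrow>
     (\<forall>n. legal_upto \<beta> \<sigma> B n \<longrightarrow> legal_move (1/2) (B n) (reply \<sigma> B n)) \<and>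
     ((\<forall>n. legal_upto \<beta> \<sigma> B n) \<longrightarrow> (\<exists>x\<in>X. (\<Inter>n. B n) = {x}))"
proof -
  define \<rho> where "\<rho> n = (v - u) * (\<beta>/2) ^ n" for n
  have \<rho>_pos: "0 < \<rho> n" for n using \<beta> uv by (simp add: \<rho>_def)
  define P where "P m \<kappa> S pq \<longleftrightarrow>
    Ob m \<kappa> \<inter> S \<subseteq> {fst pq<..<snd pq} \<and> snd pq - fst pq \<le> \<rho> (m + d \<kappa>)" for m \<kappa> S and pq :: "real \<times> real"
  \<comment> \<open>The interval covering an obstacle is fixed in the round in which the obstacle
    appears. If no such interval exists, the choice is arbitrary; the bound on \<open>pot\<close>
    survives this, because \<open>ends_in\<close> is at most 2 for any interval.\<close>
  define U where "U m \<kappa> S = (SOME pq. P m \<kappa> S pq)" for m \<kappa> S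
  \<comment> \<open>An obstacle enters with weight \<open>(2/3) ^ d \<kappa>\<close> and gains a
    factor \<open>3/2\<close> per round, so its weight is exactly 1 at its deadline,
    \<open>d \<kappa>\<close> rounds later.\<close>
  define pot where "pot B n l r = (\<Sum>m\<le>n. (3/2) ^ (n - m) *
      (\<Sum>\<kappa>\<le>g m. (2/3) ^ d \<kappa> * ends_in (fst (U m \<kappa> (B m))) (snd (U m \<kappa> (B m))) l r))"
    for B :: "nat \<Rightarrow> real set" and n l r
  define half where "half B n = (let l = Inf (B n); r = Sup (B n); c = (l + r) / 2 in
      if pot B n l c \<le> pot B n c r then {l..c} else {c..r})" for B :: "nat \<Rightarrow> real set" and n
  define \<sigma> where "\<sigma> h = half (\<lambda>m. h ! m) (length h - 1)" for h
  have pot_cong: "pot B n l r = pot B' n l r" if "\<And>m. m \<le> n \<Longrightarrow> B m = B' m" for B B' n l r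
    unfolding pot_def using that by simp
  have reply: "reply \<sigma> B n = half B n" for B n
  proof -
    have *: "map B [0..<Suc n] ! m = B m" if "m \<le> n" for m
      using that by (simp add: nth_append del: upt_Suc)
    show ?thesis
      unfolding reply_def \<sigma>_def half_def
      using pot_cong[of n "\<lambda>m. map B [0..<Suc n] ! m" B] *
      by (simp add: Let_def del: upt_Suc)
  qed
  have pot_split: "pot B n l r = pot B n l c + pot B n c r" if "l \<le> c" "c \<le> r" for B n l c r
    unfolding pot_def
    by (simp add: ends_in_split[OF that] ring_distribs sum.distrib)
  have pot_mono: "pot B n l' r' \<le> pot B n l r" if "l \<le> l'" "r' \<le> r" for B n l l' r r'
    unfolding pot_def
    by (intro sum_mono mult_left_mono ends_in_mono that) auto
  have new: "(\<Sum>\<kappa>\<le>g m. (2/3) ^ d \<kappa> * ends_in (p \<kappa>) (q \<kappa>) l r) \<le> 1/5" for m p q l r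
  proof -
    have "(\<Sum>\<kappa>\<le>g m. (2/3) ^ d \<kappa> * ends_in (p \<kappa>) (q \<kappa>) l r) \<le> (\<Sum>\<kappa>\<le>g m. (2/3) ^ d \<kappa> * 2)"
      by (intro sum_mono mult_left_mono ends_in_le_2) auto
    then show ?thesis using weight[of m] by (simp add: mult.commute)
  qed
  have half_Icc: "\<exists>x' y'. half B n = {x'..y'} \<and> x \<le> x' \<and> y' \<le> y \<and> 2 * (y' - x') = y - x \<and>
      pot B n x' y' \<le> pot B n x y / 2"
    if "B n = {x..y}" "x < y" for B n x y
  proof -
    let ?c = "(x + y) / 2"
    have IS: "Inf (B n) = x" "Sup (B n) = y" using that by auto
    have s: "pot B n x y = pot B n x ?c + pot B n ?c y"
      using that by (intro pot_split) auto
    have h: "half B n = (if pot B n x ?c \<le> pot B n ?c y then {x..?c} else {?c..y})"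
      unfolding half_def IS Let_def ..
    show ?thesis
    proof (cases "pot B n x ?c \<le> pot B n ?c y")
      case True
      then show ?thesis using s h that
        by (intro exI[of _ x] exI[of _ ?c]) (auto simp: field_simps)
    next
      case False
      then show ?thesis using s h that
        by (intro exI[of _ ?c] exI[of _ y]) (auto simp: field_simps)
    qed
  qed
  \<comment> \<open>The bound 4/5 reproduces itself: \<open>3/2 * (4/5) / 2 + 1/5 = 4/5\<close>,
    where \<open>3/2\<close> is the growth of the weights, the division by 2 is the effect of
    choosing the better half, and \<open>1/5\<close> bounds the new obstacles.\<close>
  have play: "\<exists>x y. B n = {x..y} \<and> u \<le> x \<and> y \<le> v \<and> y - x = \<rho> n \<and> pot B n x y \<le> 4/5"
    if "B 0 = {u..v}" "legal_upto \<beta> \<sigma> B n" for B n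
    using that(2)
  proof (induction n)
    case 0
    have "pot B 0 u v \<le> 1/5" unfolding pot_def using new by simp
    then show ?case using that(1) by (intro exI[of _ u] exI[of _ v]) (auto simp: \<rho>_def)
  next
    case (Suc n)
    then obtain x y where xy: "B n = {x..y}" "u \<le> x" "y \<le> v" "y - x = \<rho> n" "pot B n x y \<le> 4/5"
      by (auto simp: legal_upto_Suc)
    have "x < y" using xy(4) \<rho>_pos[of n] by linarith
    then obtain x' y' where h: "half B n = {x'..y'}" "x \<le> x'" "y' \<le> y" "2 * (y' - x') = y - x"
        "pot B n x' y' \<le> pot B n x y / 2"
      using half_Icc xy(1) by blast
    have "x' \<le> y'" using h(4) \<open>x < y\<close> by simp
    have "legal_move \<beta> {x'..y'} (B (Suc n))"
      using Suc.prems reply h(1) by (simp add: legal_upto_Suc)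
    then obtain x'' y'' where B: "B (Suc n) = {x''..y''}" "x'' < y''" "x' \<le> x''" "y'' \<le> y'"
        "y'' - x'' = \<beta> * (y' - x')"
      using legal_move_Icc \<open>x' \<le> y'\<close> by metis
    have "pot B (Suc n) x'' y'' = 3/2 * pot B n x'' y'' +
        (\<Sum>\<kappa>\<le>g (Suc n). (2/3) ^ d \<kappa> *
          ends_in (fst (U (Suc n) \<kappa> (B (Suc n)))) (snd (U (Suc n) \<kappa> (B (Suc n)))) x'' y'')"
      unfolding pot_def by (simp add: sum_distrib_left Suc_diff_le mult.assoc)
    also have "\<dots> \<le> 3/2 * pot B n x' y' + 1/5"
      using pot_mono[OF B(3,4), of B n] by (intro add_mono new) auto
    finally have "pot B (Suc n) x'' y'' \<le> 4/5" using h(5) xy(5) by linarith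
    moreover have "y'' - x'' = \<rho> (Suc n)"
      using B(5) h(4) xy(4) by (simp add: \<rho>_def)
    ultimately show ?case using B h xy by (intro exI[of _ x''] exI[of _ y'']) auto
  qed
  have legal: "legal_move (1/2) (B n) (reply \<sigma> B n)"
    if B0: "B 0 = {u..v}" and leg: "legal_upto \<beta> \<sigma> B n" for B n
  proof -
    obtain x y where xy: "B n = {x..y}" "y - x = \<rho> n"
      using play[OF B0 leg] by blast
    have "x < y" using xy(2) \<rho>_pos[of n] by linarith
    then obtain x' y' where h: "half B n = {x'..y'}" "x \<le> x'" "y' \<le> y" "2 * (y' - x') = y - x"
      using half_Icc xy(1) by blast
    have "x' < y'" using h(4) \<open>x < y\<close> by simp
    then show ?thesis
      using h xy(1) \<open>x < y\<close> unfolding legal_move_def closed_interval_def reply by auto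
  qed
  have win: "\<exists>x\<in>X. (\<Inter>n. B n) = {x}"
    if B0: "B 0 = {u..v}" and leg: "\<And>n. legal_upto \<beta> \<sigma> B n" for B
  proof -
    have "\<exists>x y. B n = {x..y} \<and> u \<le> x \<and> y \<le> v \<and> y - x = \<rho> n \<and> pot B n x y \<le> 4/5" for n
      using play[OF B0 leg] .
    then obtain l r where lr: "\<And>n. B n = {l n..r n}" "\<And>n. u \<le> l n" "\<And>n. r n \<le> v"
        "\<And>n. r n - l n = \<rho> n" "\<And>n. pot B n (l n) (r n) \<le> 4/5"
      by metis
    have lr_less: "l n < r n" for n using lr(4)[of n] \<rho>_pos[of n] by linarith
    have step: "B (Suc n) \<subseteq> B n" for n
      using leg[of "Suc n"] legal[OF B0 leg, of n] unfolding legal_upto_Suc legal_move_def by blast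
    have decr: "B n \<subseteq> B m" if "m \<le> n" for m n
      using that step by (rule lift_Suc_antimono_le[rotated])
    \<comment> \<open>Strong induction on \<open>t\<close>: \<open>single\<close> asks that
      everything due by round \<open>n\<close> be avoided already, and \<open>n < t\<close> because
      every delay is at least 1. Only here is \<open>U\<close> known to cover the obstacle.\<close>
    have avoid: "Ob n \<kappa> \<inter> B t = {}" if "\<kappa> \<le> g n" "n + d \<kappa> \<le> t" for n \<kappa> t
      using that
    proof (induction t arbitrary: n \<kappa> rule: less_induct)
      case (less t)
      have "n < t" using less.prems d_pos[of \<kappa>] by linarith
      have "\<exists>p q. Ob n \<kappa> \<inter> {l n..r n} \<subseteq> {p<..<q} \<and> q - p \<le> (v - u) * (\<beta>/2) ^ (n + d \<kappa>)"
      proof (rule single[OF less.prems(1)])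
        show "{l n..r n} \<subseteq> {u..v}" using lr(2,3)[of n] by auto
        show "r n - l n = (v - u) * (\<beta>/2) ^ n" using lr(4) \<rho>_def by simp
        show "Ob n' \<kappa>' \<inter> {l n..r n} = {}" if "\<kappa>' \<le> g n'" "n' + d \<kappa>' \<le> n" for n' \<kappa>'
          using less.IH[OF \<open>n < t\<close> that] lr(1) by simp
      qed
      then have "\<exists>pq. P n \<kappa> (B n) pq" unfolding P_def lr(1) \<rho>_def by simp
      then have PU: "P n \<kappa> (B n) (U n \<kappa> (B n))" unfolding U_def by (rule someI_ex)
      let ?t = "n + d \<kappa>" and ?p = "fst (U n \<kappa> (B n))" and ?q = "snd (U n \<kappa> (B n))"
      let ?E = "ends_in ?p ?q (l ?t) (r ?t)"
      have "?E = (3/2) ^ (?t - n) * ((2/3) ^ d \<kappa> * ?E)"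
        by (simp add: power_divide)
      also have "\<dots> \<le> (3/2) ^ (?t - n) * (\<Sum>\<kappa>\<le>g n. (2/3) ^ d \<kappa> *
          ends_in (fst (U n \<kappa> (B n))) (snd (U n \<kappa> (B n))) (l ?t) (r ?t))"
        using less.prems(1)
        by (intro mult_left_mono
              member_le_sum[where f = "\<lambda>\<kappa>. (2/3) ^ d \<kappa> *
                ends_in (fst (U n \<kappa> (B n))) (snd (U n \<kappa> (B n))) (l ?t) (r ?t)"])
           (auto simp: ends_in_nonneg)
      also have "\<dots> \<le> pot B ?t (l ?t) (r ?t)"
        unfolding pot_def
        by (intro member_le_sum[where f = "\<lambda>m. (3/2) ^ (?t - m) * (\<Sum>\<kappa>\<le>g m. (2/3) ^ d \<kappa> *
              ends_in (fst (U m \<kappa> (B m))) (snd (U m \<kappa> (B m))) (l ?t) (r ?t))"])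
           (auto intro!: mult_nonneg_nonneg sum_nonneg ends_in_nonneg)
      also have "\<dots> < 1" using lr(5)[of ?t] by linarith
      finally have "?E < 1" .
      moreover have "?q - ?p \<le> r ?t - l ?t" using PU unfolding P_def lr(4) by blast
      ultimately have "{?p<..<?q} \<inter> B ?t = {}"
        unfolding lr(1)[of ?t] by (rule disjoint_if_ends_in_less_1)
      then have "Ob n \<kappa> \<inter> B ?t = {}" using PU decr[of n ?t] unfolding P_def by auto
      then show ?case using decr[of ?t t] less.prems by blast
    qed
    have "\<rho> \<longlonglongrightarrow> (v - u) * 0"
      unfolding \<rho>_def using \<beta> by (intro tendsto_mult tendsto_const LIMSEQ_realpow_zero) auto
    then have \<rho>_0: "\<rho> \<longlonglongrightarrow> 0" by simp
    have "\<exists>x. x \<in> (\<Inter>n. B n)"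
    proof -
      have "(\<Inter>n. B n) \<noteq> {}"
      proof (rule compact_nest)
        show "compact (B n)" "B n \<noteq> {}" for n using lr_less[of n] unfolding lr(1) by auto
      qed (rule decr)
      then show ?thesis by blast
    qed
    then obtain x where x: "\<And>n. x \<in> B n" by blast
    have uniq: "y = x" if "\<And>n. y \<in> B n" for y
    proof -
      have "\<bar>y - x\<bar> \<le> \<rho> n" for n
        using that[of n] x[of n] lr(4)[of n] unfolding lr(1) by auto
      then have "\<bar>y - x\<bar> \<le> 0" using \<rho>_0 by (intro LIMSEQ_le_const[OF \<rho>_0]) auto
      then show ?thesis by simp
    qed
    have "x \<in> X"
    proof (rule target)
      show "x \<in> {u..v}" using x[of 0] B0 by simp
      show "x \<notin> Ob n \<kappa>" if "\<kappa> \<le> g n" for n \<kappa>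
        using avoid[OF that order_refl] x by blast
    qed
    moreover have "(\<Inter>n. B n) = {x}" using x uniq by blast
    ultimately show ?thesis by blast
  qed
  show ?thesis using legal win by blast
qed

text \<open>The constants of the construction depend on the first interval of B, so there is one
  strategy per start. They are glued by reading the start off the head of the history.\<close>

lemma winning2_if_each_start:
  assumes "\<And>u v. u < v \<Longrightarrow> \<exists>\<sigma>. \<forall>B. B 0 = {u..v} \<longrightarrow>
     (\<forall>n. legal_upto \<beta> \<sigma> B n \<longrightarrow> legal_move \<alpha> (B n) (reply \<sigma> B n)) \<and>
     ((\<forall>n. legal_upto \<beta> \<sigma> B n) \<longrightarrow> (\<exists>x\<in>X. (\<Inter>n. B n) = {x}))"
  shows "winning2 \<alpha> \<beta> X"
proof -
  define good where "good \<sigma> B \<longleftrightarrow>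
     (\<forall>n. legal_upto \<beta> \<sigma> B n \<longrightarrow> legal_move \<alpha> (B n) (reply \<sigma> B n)) \<and>
     ((\<forall>n. legal_upto \<beta> \<sigma> B n) \<longrightarrow> (\<exists>x\<in>X. (\<Inter>n. B n) = {x}))" for \<sigma> B
  define S where "S I = (SOME \<sigma>. \<forall>B. B 0 = I \<longrightarrow> good \<sigma> B)" for I
  have S: "good (S (B 0)) B" if "closed_interval (B 0)" for B
  proof -
    obtain u v where "u < v" "B 0 = {u..v}" using \<open>closed_interval (B 0)\<close> unfolding closed_interval_def by blast
    with assms have "\<exists>\<sigma>. \<forall>B'. B' 0 = B 0 \<longrightarrow> good \<sigma> B'" unfolding good_def by simp
    then have "\<forall>B'. B' 0 = B 0 \<longrightarrow> good (S (B 0)) B'" unfolding S_def by (rule someI_ex)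
    then show ?thesis by blast
  qed
  define \<sigma> where "\<sigma> h = S (hd h) h" for h
  have reply: "reply \<sigma> B n = reply (S (B 0)) B n" for B n
    unfolding reply_def \<sigma>_def by (simp add: upt_conv_Cons del: upt_Suc)
  have legal: "legal_upto \<beta> \<sigma> B n \<longleftrightarrow> legal_upto \<beta> (S (B 0)) B n" for B n
    unfolding legal_upto_def reply ..
  have "good \<sigma> B" for B
  proof (cases "closed_interval (B 0)")
    case True
    then show ?thesis using S[of B] unfolding good_def reply legal by blast
  next
    case False
    then show ?thesis unfolding good_def legal_upto_def by blast
  qed
  then show ?thesis unfolding winning2_def good_def by blast
qed

section \<open>Rational points and rational lines near a line\<close>

lemma dist_int_attained:
  obtains p :: int where "dist_int t = \<bar>t - of_int p\<bar>"
proof -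
  have "closed (\<int> :: real set)" "(\<int> :: real set) \<noteq> {}" by auto
  then obtain z where "z \<in> \<int>" "infdist t \<int> = dist t z" by (rule infdist_attains_inf)
  then show thesis using that unfolding dist_int_def dist_real_def by (auto elim!: Ints_cases)
qed

text \<open>Each exponent \<open>t\<close> occurs for at most \<open>N\<close> indices, and the
  geometric series sums to 3. This bounds the total weight of the slope classes, whose delay grows
  by one every \<open>N\<close> classes.\<close>

lemma sum_power_div_le:
  assumes "0 < N"
  shows "(\<Sum>l\<le>M. (2/3) ^ (l div N) :: real) \<le> 3 * N"
proof -
  have "(\<Sum>l\<le>M. (2/3) ^ (l div N) :: real) \<le> (\<Sum>l<Suc M * N. (2/3) ^ (l div N))"
  proof (rule sum_mono2)
    show "{..M} \<subseteq> {..<Suc M * N}"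
    proof
      fix l assume "l \<in> {..M}"
      then have "l < Suc M * 1" by simp
      also have "\<dots> \<le> Suc M * N" using assms by (intro mult_le_mono2) simp
      finally show "l \<in> {..<Suc M * N}" by simp
    qed
  qed auto
  also have "\<dots> = (\<Sum>t<Suc M. \<Sum>l=t*N..<t*N+N. (2/3) ^ (l div N))"
    by (rule sum.nat_group[symmetric])
  also have "\<dots> = (\<Sum>t<Suc M. N * (2/3) ^ t)"
  proof (rule sum.cong[OF refl])
    fix t
    have "(\<Sum>l=t*N..<t*N+N. (2/3) ^ (l div N) :: real) = (\<Sum>l=t*N..<t*N+N. (2/3) ^ t)"
    proof (rule sum.cong[OF refl])
      fix l assume "l \<in> {t*N..<t*N+N}"
      then have "l div N = t" by (intro div_nat_eqI) (auto simp: mult.commute)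
      then show "(2/3) ^ (l div N) = ((2/3) ^ t :: real)" by simp
    qed
    then show "(\<Sum>l=t*N..<t*N+N. (2/3) ^ (l div N) :: real) = N * (2/3) ^ t" by simp
  qed
  also have "\<dots> = N * (\<Sum>t<Suc M. (2/3) ^ t)" by (rule sum_distrib_left[symmetric])
  also have "\<dots> \<le> real N * 3"
  proof (rule mult_left_mono)
    show "(\<Sum>t<Suc M. (2/3) ^ t) \<le> (3::real)" by (subst sum_gp_strict) (simp add: field_simps)
  qed simp
  finally show ?thesis by simp
qed

lemma abs_cross_diff_le:
  fixes x y x' y' M K :: real
  assumes "\<bar>x\<bar> \<le> M" "\<bar>x'\<bar> \<le> M" "\<bar>y\<bar> \<le> K" "\<bar>y'\<bar> \<le> K"
  shows "\<bar>x * y - x' * y'\<bar> \<le> 2 * (M * K)"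
proof -
  have "\<bar>x * y\<bar> \<le> M * K" "\<bar>x' * y'\<bar> \<le> M * K"
    unfolding abs_mult using assms by (intro mult_mono; linarith)+
  then show ?thesis by linarith
qed

text \<open>
  \<open>slope\<close> is the form in which the Diophantine condition on \<open>(a, b)\<close> is used; \<open>\<delta>\<close> will be
  \<open>min (\<epsilon> * j) 1\<close>, or 1 for rational \<open>a\<close>. The game is played with \<open>Y ^ N = 2 / \<beta>\<close>, the factor by which the
  intervals shrink in each round.
\<close>

locale line_obstacles =
  fixes i j a b u v c\<^sub>1 \<delta> Y :: real and N D e m G :: nat
  assumes ij: "0 < j" "j \<le> i" "i + j = 1"
    and uv: "u < v"
    and Y: "1 < Y" "2 \<le> Y ^ N"
    and N: "5 \<le> N" "4 \<le> \<delta> * N"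
    and c1: "0 < c\<^sub>1" "c\<^sub>1 \<le> 1"
    and slope: "\<And>(A::int) (B::int) (C::int) (x::real) (T::real). A \<noteq> 0 \<or> B \<noteq> 0 \<Longrightarrow> x \<in> {u..v} \<Longrightarrow> 1 \<le> T \<Longrightarrow>
        \<bar>of_int B\<bar> \<le> T powr j \<Longrightarrow> \<bar>A * x + B * (a * x + b) + C\<bar> < c\<^sub>1 / T \<Longrightarrow>
        c\<^sub>1 * T powr (\<delta> - 1) \<le> \<bar>A + a * B\<bar>"
    and e: "16 * (1 + \<bar>a\<bar>) ^ 3 * (Y ^ N)\<^sup>2 \<le> (Y ^ N) ^ e"
    and m: "(v - u) * (16 * (1 + \<bar>a\<bar>) ^ 3 * (Y ^ N) ^ (2 * D + e + 4)) \<le> c\<^sub>1 * (Y ^ N) ^ m"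
    and G: "1 + \<bar>a\<bar> \<le> c\<^sub>1 * (Y ^ N) ^ G" "2 * G \<le> m"
begin

definition R where "R = Y ^ N"
definition X where "X = Y ^ (N - 1)"
definition a\<^sub>1 where "a\<^sub>1 = 1 + \<bar>a\<bar>"
text \<open>The exponent is chosen so that \<open>T k * Ti k = R ^ k\<close>: a rational point of
  denominator about \<open>T k\<close> is an obstacle of length about
  \<open>1 / (T k * Ti k)\<close>, so scales advance in step with the rounds of the game.\<close>

definition T where "T k = R powr (real k / (1 + i))"
definition Ti where "Ti k = T k powr i"
definition Tj where "Tj k = T k powr j"
text \<open>In each factor \<open>R ^ (D + 2)\<close> the part \<open>R ^ D\<close> accounts for the
  delay of \<open>D\<close> rounds; the spare \<open>R ^ 2\<close> absorbs a factor 2 and the width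
  of a class, which is \<open>R\<close> for denominators and \<open>X\<close> for slopes. The factor
  \<open>R ^ e\<close> absorbs the constants of \<open>two_lines\<close>, and \<open>R ^ m\<close>
  makes all products of errors small.\<close>

definition \<kappa>\<^sub>3 where "\<kappa>\<^sub>3 = (v - u) / R ^ m"
definition \<kappa>\<^sub>2 where "\<kappa>\<^sub>2 = \<kappa>\<^sub>3 / R ^ (D + 2)"
definition \<kappa>\<^sub>1 where "\<kappa>\<^sub>1 = \<kappa>\<^sub>2 / R ^ e"
definition c where "c = \<kappa>\<^sub>1 / R ^ (D + 2)"
definition F :: "int \<Rightarrow> int \<Rightarrow> int \<Rightarrow> real \<Rightarrow> real" where
  "F A B C x = of_int A * x + of_int B * (a * x + b) + of_int C"

text \<open>
  An interval in which the points of class \<open>k\<close> are handled has length \<open>\<kappa>\<^sub>3 / R ^ k\<close>, and they are avoided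
  to within \<open>\<kappa>\<^sub>2\<close>; for the lines of class \<open>(k, l)\<close> the length is \<open>\<kappa>\<^sub>1 * R ^ l / R ^ k\<close> and the
  accuracy is \<open>c\<close>. Since \<open>R = X * Y\<close>, a line obstacle is shorter than its interval by the factor
  \<open>Y ^ l\<close>, which makes the weights of the infinitely many slope classes \<open>l\<close> summable.
\<close>

definition point_obs :: "nat \<Rightarrow> real set" where
  "point_obs k = {x. \<exists>(q::int) (p::int) (r::int). q \<noteq> 0 \<and> \<bar>of_int q\<bar> \<le> T k \<and> T k \<le> R * \<bar>of_int q\<bar> \<and>
     \<bar>q * x - p\<bar> < \<kappa>\<^sub>2 / Ti k \<and> \<bar>q * (a * x + b) - r\<bar> < \<kappa>\<^sub>2 / Tj k}"

definition line_obs :: "nat \<Rightarrow> nat \<Rightarrow> real set" where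
  "line_obs k l = {x. \<exists>(A::int) (B::int) (C::int). (A \<noteq> 0 \<or> B \<noteq> 0) \<and> \<bar>of_int B\<bar> \<le> Tj k \<and>
     a\<^sub>1 * Ti k / X ^ (l + 1) < \<bar>A + a * B\<bar> \<and> \<bar>A + a * B\<bar> \<le> a\<^sub>1 * Ti k / X ^ l \<and>
     \<bar>F A B C x\<bar> < c / T k}"

section \<open>Growth of the scales\<close>

lemma i_bounds: "1/2 \<le> i" "0 < i" "i < 1" "0 < 1 + i"
  using ij by auto

lemma R_ge_2: "2 \<le> R"
  using Y by (simp add: R_def)

lemma X_gt_1: "1 < X"
  using Y N by (auto simp: X_def)

lemma XY: "X * Y = R"
  using N by (simp add: X_def R_def power_minus_mult del: One_nat_def)

lemma a1_ge_1: "1 \<le> a\<^sub>1"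
  by (simp add: a\<^sub>1_def)

lemma T_ge_1: "1 \<le> T k"
  unfolding T_def using R_ge_2 i_bounds by (intro ge_one_powr_ge_zero) auto

lemma Ti_ge_1: "1 \<le> Ti k"
  unfolding Ti_def using T_ge_1 i_bounds by (intro ge_one_powr_ge_zero) auto

lemma Tj_ge_1: "1 \<le> Tj k"
  unfolding Tj_def using T_ge_1 ij by (intro ge_one_powr_ge_zero) auto

lemma T_pos: "0 < T k" "0 < Ti k" "0 < Tj k"
  using T_ge_1[of k] Ti_ge_1[of k] Tj_ge_1[of k] by linarith+

lemma Ti_Tj: "Ti k * Tj k = T k"
  unfolding Ti_def Tj_def using T_pos[of k] ij by (simp flip: powr_add)

lemma T_Ti: "T k * Ti k = R ^ k"
proof -
  have "T k * Ti k = T k powr (1 + i)"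
    unfolding Ti_def using T_pos[of k] by (simp add: powr_add)
  also have "\<dots> = R powr real k"
    unfolding T_def using i_bounds by (simp add: powr_powr)
  finally show ?thesis using R_ge_2 by (simp add: powr_realpow)
qed

lemma Tj_le_Ti: "Tj k \<le> Ti k"
  unfolding Ti_def Tj_def using T_ge_1 ij by (intro powr_mono) auto

lemma T_add_le: "Ti (k + h) \<le> R ^ h * Ti k" "Tj (k + h) \<le> R ^ h * Tj k" "T k \<le> T (k + h)"
proof -
  let ?z = "R powr (real h / (1 + i))"
  have T: "T (k + h) = T k * ?z"
    unfolding T_def by (simp add: add_divide_distrib powr_add)
  have z: "1 \<le> ?z" using R_ge_2 i_bounds by (intro ge_one_powr_ge_zero) auto
  have *: "?z powr s \<le> R ^ h" if "0 < s" "s \<le> 1" for s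
  proof -
    have "?z powr s \<le> ?z powr 1" using z that by (intro powr_mono) auto
    also have "\<dots> \<le> R powr real h"
      using R_ge_2 i_bounds by (simp add: field_simps powr_mono)
    finally show ?thesis using R_ge_2 by (simp add: powr_realpow)
  qed
  show "Ti (k + h) \<le> R ^ h * Ti k"
    unfolding Ti_def T using *[of i] i_bounds T_pos[of k] z by (simp add: powr_mult mult.commute)
  show "Tj (k + h) \<le> R ^ h * Tj k"
    unfolding Tj_def T using *[of j] ij T_pos[of k] z by (simp add: powr_mult mult.commute)
  show "T k \<le> T (k + h)" unfolding T using T_pos[of k] z by simp
qed

text \<open>Consecutive scales differ by the factor \<open>R powr (1 / (1 + i))\<close>, which is at
  most \<open>R\<close>, so the first scale not below \<open>t\<close> will do.\<close>

lemma scale_exists: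
  assumes "1 \<le> t"
  obtains k where "t \<le> T k" "T k \<le> R * t"
proof
  define k where "k = nat \<lceil>(1 + i) * log R t\<rceil>"
  have "0 \<le> (1 + i) * log R t" using R_ge_2 i_bounds assms by simp
  then have k: "(1 + i) * log R t \<le> k" "k \<le> (1 + i) * log R t + 1"
    unfolding k_def by linarith+
  have "log R t \<le> k / (1 + i)" "k / (1 + i) \<le> 1 + log R t"
    using k i_bounds by (auto simp: field_simps)
  then have "R powr log R t \<le> T k" "T k \<le> R powr (1 + log R t)"
    unfolding T_def using R_ge_2 by (auto intro!: powr_mono)
  then show "t \<le> T k" "T k \<le> R * t"
    using R_ge_2 assms by (auto simp: powr_add)
qed

section \<open>Relations between the accuracies\<close>

lemma \<kappa>_pos: "0 < \<kappa>\<^sub>3" "0 < \<kappa>\<^sub>2" "0 < \<kappa>\<^sub>1" "0 < c"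
  using uv R_ge_2 by (auto simp: \<kappa>\<^sub>3_def \<kappa>\<^sub>2_def \<kappa>\<^sub>1_def c_def)

lemma \<kappa>_mono: "\<kappa>\<^sub>2 \<le> \<kappa>\<^sub>3" "\<kappa>\<^sub>1 \<le> \<kappa>\<^sub>2" "c \<le> \<kappa>\<^sub>1"
proof -
  have *: "x / R ^ n \<le> x" if "0 < x" for x n
    using that R_ge_2 by (simp add: divide_le_eq mult_le_cancel_left1 one_le_power)
  show "\<kappa>\<^sub>2 \<le> \<kappa>\<^sub>3" "\<kappa>\<^sub>1 \<le> \<kappa>\<^sub>2" "c \<le> \<kappa>\<^sub>1"
    using *[OF \<kappa>_pos(1), of "D + 2"] *[OF \<kappa>_pos(2), of e] *[OF \<kappa>_pos(3), of "D + 2"]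
    unfolding \<kappa>\<^sub>2_def[symmetric] \<kappa>\<^sub>1_def[symmetric] c_def[symmetric] .
qed

lemma \<kappa>3_small: "\<kappa>\<^sub>3 * (16 * a\<^sub>1 ^ 3 * R ^ (2 * D + e + 4)) \<le> c\<^sub>1"
  using m R_ge_2 unfolding \<kappa>\<^sub>3_def a\<^sub>1_def R_def[symmetric] by (simp add: field_simps)

lemma \<kappa>3_small': "16 * a\<^sub>1 ^ 3 * \<kappa>\<^sub>3 \<le> c\<^sub>1"
proof -
  have "\<kappa>\<^sub>3 * (16 * a\<^sub>1 ^ 3) * 1 \<le> \<kappa>\<^sub>3 * (16 * a\<^sub>1 ^ 3) * R ^ (2 * D + e + 4)"
    using R_ge_2 \<kappa>_pos a1_ge_1 by (intro mult_left_mono one_le_power) auto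
  then show ?thesis using \<kappa>3_small by (simp add: mult_ac)
qed

lemma \<kappa>1_small: "16 * a\<^sub>1 ^ 3 * \<kappa>\<^sub>1 \<le> c\<^sub>1"
proof -
  have "16 * a\<^sub>1 ^ 3 * \<kappa>\<^sub>1 \<le> 16 * a\<^sub>1 ^ 3 * \<kappa>\<^sub>3"
    using \<kappa>_mono a1_ge_1 by (intro mult_left_mono) auto
  then show ?thesis using \<kappa>3_small' by linarith
qed

lemma c_le_c1: "c \<le> c\<^sub>1"
proof -
  have "1 * \<kappa>\<^sub>3 \<le> 16 * a\<^sub>1 ^ 3 * \<kappa>\<^sub>3"
    using \<kappa>_pos one_le_power[OF a1_ge_1, of 3] by (intro mult_right_mono) linarith+
  then show ?thesis using \<kappa>3_small' \<kappa>_mono by linarith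
qed

lemma \<kappa>1_\<kappa>2: "16 * a\<^sub>1 ^ 3 * R * \<kappa>\<^sub>1 < \<kappa>\<^sub>2"
proof -
  have "16 * a\<^sub>1 ^ 3 * R < 16 * a\<^sub>1 ^ 3 * R\<^sup>2"
    using R_ge_2 a1_ge_1 by (simp add: power2_eq_square)
  also have "\<dots> \<le> R ^ e" using e by (simp add: a\<^sub>1_def R_def)
  finally have "16 * a\<^sub>1 ^ 3 * R * \<kappa>\<^sub>1 < R ^ e * \<kappa>\<^sub>1" using \<kappa>_pos by simp
  then show ?thesis using R_ge_2 by (simp add: \<kappa>\<^sub>1_def)
qed

section \<open>Slope classes of lines and their intersections\<close>

lemma F_diff: "F A B C x - F A B C y = (A + a * B) * (x - y)"
  by (simp add: F_def algebra_simps)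

text \<open>The Diophantine condition makes the slope nonzero, the height bounds make it at most
  \<open>a\<^sub>1 * Ti k\<close>, and the slope windows of the classes \<open>l\<close> tile
  everything between.\<close>

lemma line_class_exists:
  assumes "A \<noteq> 0 \<or> B \<noteq> 0" "x \<in> {u..v}" "\<bar>of_int A\<bar> \<le> Ti k" "\<bar>of_int B\<bar> \<le> Tj k" "\<bar>F A B C x\<bar> < c / T k"
  obtains l where "x \<in> line_obs k l"
proof -
  have "c / T k \<le> c\<^sub>1 / T k" using c_le_c1 T_pos[of k] by (simp add: divide_right_mono)
  then have "c\<^sub>1 * T k powr (\<delta> - 1) \<le> \<bar>A + a * B\<bar>"
    using slope[of A B x "T k" C] assms T_ge_1 by (simp add: F_def Tj_def)
  moreover have "0 < c\<^sub>1 * T k powr (\<delta> - 1)" using c1 T_pos[of k] by simp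
  ultimately have s_pos: "0 < \<bar>A + a * B\<bar>" by linarith
  have "\<bar>A + a * B\<bar> \<le> \<bar>of_int A\<bar> + \<bar>a\<bar> * \<bar>of_int B\<bar>" using abs_triangle_ineq[of A "a * B"] by (simp add: abs_mult)
  also have "\<dots> \<le> Ti k + \<bar>a\<bar> * Ti k"
    using assms Tj_le_Ti[of k] by (intro add_mono mult_left_mono) auto
  finally have s_le: "\<bar>A + a * B\<bar> \<le> a\<^sub>1 * Ti k" by (simp add: a\<^sub>1_def algebra_simps)
  obtain n where "a\<^sub>1 * Ti k / \<bar>A + a * B\<bar> < X ^ n" using real_arch_pow[OF X_gt_1] by blast
  then have "\<exists>n. a\<^sub>1 * Ti k / X ^ n < \<bar>A + a * B\<bar>"
    using s_pos X_gt_1 by (intro exI[of _ n]) (simp add: field_simps)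
  then obtain n where n: "a\<^sub>1 * Ti k / X ^ n < \<bar>A + a * B\<bar>"
      "\<And>n'. n' < n \<Longrightarrow> \<not> a\<^sub>1 * Ti k / X ^ n' < \<bar>A + a * B\<bar>"
    using exists_least_iff[of "\<lambda>n. a\<^sub>1 * Ti k / X ^ n < \<bar>A + a * B\<bar>"] by blast
  have "n \<noteq> 0" using n(1) s_le by (intro notI) simp
  then obtain l where "n = l + 1" by (metis Suc_eq_plus1 not0_implies_Suc)
  then have "x \<in> line_obs k l"
    using n(1) n(2)[of l] assms unfolding line_obs_def by (auto simp: not_less)
  then show thesis by (rule that)
qed

text \<open>The upper end of the slope window is compared with the lower bound \<open>slope\<close>.
  The first estimate serves the parallel case of \<open>two_lines\<close>. The second says that
  \<open>l\<close> grows more slowly than \<open>k\<close>, the ratio being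
  \<open>(N - 2) / (N - 1)\<close>; hence only finitely many slope classes matter in each
  round.\<close>

lemma line_class_bound:
  assumes "x \<in> line_obs k l" "x \<in> {u..v}"
  shows "c\<^sub>1 * X ^ l \<le> a\<^sub>1 * R ^ k" "(N - 1) * l \<le> N * G + (N - 2) * k"
proof -
  obtain A B C :: int where L: "A \<noteq> 0 \<or> B \<noteq> 0" "\<bar>of_int B\<bar> \<le> Tj k"
      "\<bar>A + a * B\<bar> \<le> a\<^sub>1 * Ti k / X ^ l" "\<bar>F A B C x\<bar> < c / T k"
    using assms(1) unfolding line_obs_def by auto
  have "c / T k \<le> c\<^sub>1 / T k" using c_le_c1 T_pos[of k] by (simp add: divide_right_mono)
  then have "c\<^sub>1 * T k powr (\<delta> - 1) \<le> \<bar>A + a * B\<bar>"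
    using slope[of A B x "T k" C] assms L T_ge_1 by (simp add: F_def Tj_def)
  then have "c\<^sub>1 * T k powr (\<delta> - 1) \<le> a\<^sub>1 * Ti k / X ^ l" using L(3) by linarith
  then have "c\<^sub>1 * X ^ l * T k powr (\<delta> - 1) \<le> a\<^sub>1 * Ti k" using X_gt_1 by (simp add: field_simps)
  then have "c\<^sub>1 * X ^ l * T k powr (\<delta> - 1) * T k powr (1 - \<delta>) \<le> a\<^sub>1 * Ti k * T k powr (1 - \<delta>)"
    using T_pos[of k] by (intro mult_right_mono) auto
  also have "c\<^sub>1 * X ^ l * T k powr (\<delta> - 1) * T k powr (1 - \<delta>) = c\<^sub>1 * X ^ l"
    using T_pos[of k] by (simp add: mult.assoc flip: powr_add)
  also have "a\<^sub>1 * Ti k * T k powr (1 - \<delta>) = a\<^sub>1 * T k powr (1 + i - \<delta>)"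
    unfolding Ti_def using T_pos[of k] by (simp add: mult.assoc flip: powr_add) (simp add: algebra_simps)
  finally have main: "c\<^sub>1 * X ^ l \<le> a\<^sub>1 * T k powr (1 + i - \<delta>)" .
  have "T k powr (1 + i - \<delta>) = Y powr (N * (k * ((1 + i - \<delta>) / (1 + i))))"
    unfolding T_def R_def using Y by (simp add: powr_powr mult_ac flip: powr_realpow)
  \<comment> \<open>The gain \<open>\<delta>\<close> becomes a whole number of factors
    \<open>Y\<close>: from \<open>4 \<le> \<delta> * N\<close> and \<open>1 + i \<le> 2\<close>
    follows \<open>2 \<le> N * \<delta> / (1 + i)\<close>.\<close>
  also have "\<dots> \<le> Y powr ((N - 2) * k)"
  proof -
    have "0 < \<delta> * real N" using N by linarith
    then have "0 < \<delta>" using N by (simp add: zero_less_mult_iff)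
    then have "\<delta> / 2 \<le> \<delta> / (1 + i)" using i_bounds by (intro divide_left_mono) auto
    then have "N * (\<delta> / 2) \<le> N * (\<delta> / (1 + i))" by (intro mult_left_mono) auto
    moreover have "N * (\<delta> / 2) = \<delta> * N / 2" by simp
    ultimately have "2 \<le> N * (\<delta> / (1 + i))" using N(2) by linarith
    then have "N * (1 - \<delta> / (1 + i)) \<le> real N - 2" unfolding right_diff_distrib by simp
    then have "k * (N * (1 - \<delta> / (1 + i))) \<le> k * (real N - 2)" by (intro mult_left_mono) auto
    moreover have "(1 + i - \<delta>) / (1 + i) = 1 - \<delta> / (1 + i)" using i_bounds by (simp add: field_simps)
    ultimately have "N * (k * ((1 + i - \<delta>) / (1 + i))) \<le> (N - 2) * k"
      using N by (simp add: of_nat_diff mult_ac)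
    then show ?thesis using Y by (intro powr_mono) auto
  qed
  also have "\<dots> = Y ^ ((N - 2) * k)" using Y by (simp add: powr_realpow flip: of_nat_mult)
  finally have T_le: "T k powr (1 + i - \<delta>) \<le> Y ^ ((N - 2) * k)" .
  also have "\<dots> \<le> R ^ k" unfolding R_def using Y by (simp add: power_increasing flip: power_mult)
  finally show "c\<^sub>1 * X ^ l \<le> a\<^sub>1 * R ^ k"
    using main a1_ge_1 by (meson mult_left_mono order_trans zero_le_one)
  have "c\<^sub>1 * X ^ l \<le> a\<^sub>1 * Y ^ ((N - 2) * k)"
    using main T_le a1_ge_1 by (meson mult_left_mono order_trans zero_le_one)
  also have "\<dots> \<le> c\<^sub>1 * (Y ^ N) ^ G * Y ^ ((N - 2) * k)"
    using G Y by (intro mult_right_mono) (auto simp: a\<^sub>1_def)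
  finally have "X ^ l \<le> (Y ^ N) ^ G * Y ^ ((N - 2) * k)" using c1 by (simp add: mult.assoc)
  then have "Y ^ ((N - 1) * l) \<le> Y ^ (N * G + (N - 2) * k)"
    by (simp add: X_def power_mult power_add)
  then show "(N - 1) * l \<le> N * G + (N - 2) * k" using Y by (simp add: power_increasing_iff)
qed

text \<open>
  The cross product of the two lines is their common rational point, of denominator \<open>\<bar>q\<bar>\<close>. If \<open>q = 0\<close>,
  its integer coordinates are too small to be nonzero, so the lines are proportional.
\<close>

lemma two_lines:
  fixes A B C A' B' C' :: int
  assumes B: "\<bar>of_int B\<bar> \<le> Tj k" "\<bar>of_int B'\<bar> \<le> Tj k"
    and s: "\<bar>A + a * B\<bar> \<le> a\<^sub>1 * Ti k / X ^ l" "\<bar>A' + a * B'\<bar> \<le> a\<^sub>1 * Ti k / X ^ l"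
    and Fx: "\<bar>F A B C x\<bar> \<le> 2 * a\<^sub>1 * \<kappa>\<^sub>1 * Y ^ l / T k" "\<bar>F A' B' C' x\<bar> \<le> 2 * a\<^sub>1 * \<kappa>\<^sub>1 * Y ^ l / T k"
    and bound: "c\<^sub>1 * X ^ l \<le> a\<^sub>1 * R ^ k"
  shows "(\<exists>k'. k' + l \<le> k + e \<and> x \<in> point_obs k') \<or>
         (\<forall>z. (A + a * B) * F A' B' C' z = (A' + a * B') * F A B C z)"
proof -
  define q p r where "q = A * B' - A' * B" and "p = C' * B - C * B'" and "r = A' * C - A * C'"
  let ?s = "A + a * B" and ?s' = "A' + a * B'"
  let ?f = "2 * a\<^sub>1 * \<kappa>\<^sub>1 * Y ^ l / T k"
  have q_eq: "real_of_int q = ?s * B' - ?s' * B" by (simp add: q_def algebra_simps)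
  have p_eq: "q * x - p = B' * F A B C x - B * F A' B' C' x"
    by (simp add: q_def p_def F_def algebra_simps)
  have r_eq: "q * (a * x + b) - r = (?s * F A' B' C' x - ?s' * F A B C x) + a * (q * x - p)"
    by (simp add: q_def p_def r_def F_def algebra_simps)
  have VZ: "1 \<le> Y ^ l" "Y ^ l \<le> X ^ l" "(Y ^ l) ^ 4 \<le> X ^ l" "X ^ l * Y ^ l = R ^ l" "1 \<le> X ^ l"
  proof -
    show "1 \<le> Y ^ l" "1 \<le> X ^ l" using Y X_gt_1 by (auto intro: one_le_power)
    have "Y ^ 1 \<le> X" "Y ^ 4 \<le> X" unfolding X_def using N Y by (intro power_increasing; simp)+
    then show "Y ^ l \<le> X ^ l" "(Y ^ l) ^ 4 \<le> X ^ l"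
      using Y power_mono[of "Y ^ 4" X l] by (auto intro!: power_mono simp: mult.commute simp flip: power_mult)
    show "X ^ l * Y ^ l = R ^ l" using XY by (simp flip: power_mult_distrib)
  qed
  \<comment> \<open>The denominator of the intersection point gains the factor \<open>X ^ l\<close>.
    Since \<open>1/2 \<le> i\<close>, even the power \<open>i\<close> of this gain outweighs the
    loss \<open>Y ^ l\<close> in \<open>p_le\<close>.\<close>
  have Z_powr: "Y ^ l \<le> (X ^ l) powr i" "1 \<le> (X ^ l) powr j"
  proof -
    have "(Y ^ l)\<^sup>2 \<le> (Y ^ l) ^ 4" using VZ(1) by (intro power_increasing) auto
    then have "Y ^ l \<le> sqrt (X ^ l)" using VZ by (intro real_le_rsqrt) auto
    also have "\<dots> = (X ^ l) powr (1/2)" using VZ by (simp add: powr_half_sqrt)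
    also have "\<dots> \<le> (X ^ l) powr i" using VZ i_bounds by (intro powr_mono) auto
    finally show "Y ^ l \<le> (X ^ l) powr i" .
    show "1 \<le> (X ^ l) powr j" using VZ ij by (intro ge_one_powr_ge_zero) auto
  qed
  have q_le: "\<bar>of_int q\<bar> * X ^ l \<le> 2 * a\<^sub>1 * T k"
  proof -
    have "\<bar>real_of_int q\<bar> \<le> 2 * (a\<^sub>1 * Ti k / X ^ l * Tj k)"
      unfolding q_eq by (intro abs_cross_diff_le s B)
    also have "\<dots> = 2 * a\<^sub>1 * T k / X ^ l" by (simp flip: Ti_Tj)
    finally show ?thesis using VZ by (simp add: field_simps)
  qed
  have p_le: "\<bar>q * x - p\<bar> \<le> 4 * a\<^sub>1 * \<kappa>\<^sub>1 * (Y ^ l / Ti k)"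
  proof -
    have "\<bar>q * x - p\<bar> \<le> 2 * (Tj k * ?f)"
      unfolding p_eq by (intro abs_cross_diff_le B Fx)
    also have "\<dots> = 4 * a\<^sub>1 * \<kappa>\<^sub>1 * (Y ^ l / Ti k)"
      using T_pos[of k] by (simp flip: Ti_Tj)
    finally show ?thesis .
  qed
  have r_le: "\<bar>q * (a * x + b) - r\<bar> \<le> 4 * a\<^sub>1\<^sup>2 * \<kappa>\<^sub>1 / Tj k + a\<^sub>1 * \<bar>q * x - p\<bar>"
  proof -
    have "\<bar>?s * F A' B' C' x - ?s' * F A B C x\<bar> \<le> 2 * (a\<^sub>1 * Ti k / X ^ l * ?f)"
      by (intro abs_cross_diff_le s Fx)
    also have "\<dots> = 4 * a\<^sub>1\<^sup>2 * \<kappa>\<^sub>1 / Tj k * (Y ^ l / X ^ l)"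
      using T_pos[of k] by (simp add: power2_eq_square mult_ac flip: Ti_Tj)
    also have "\<dots> \<le> 4 * a\<^sub>1\<^sup>2 * \<kappa>\<^sub>1 / Tj k * 1"
      using VZ \<kappa>_pos T_pos[of k] by (intro mult_left_mono) auto
    finally have 1: "\<bar>?s * F A' B' C' x - ?s' * F A B C x\<bar> \<le> 4 * a\<^sub>1\<^sup>2 * \<kappa>\<^sub>1 / Tj k" by simp
    have "\<bar>a * (q * x - p)\<bar> \<le> a\<^sub>1 * \<bar>q * x - p\<bar>"
      unfolding abs_mult by (intro mult_right_mono) (auto simp: a\<^sub>1_def)
    with 1 show ?thesis unfolding r_eq by linarith
  qed
  show ?thesis
  proof (cases "q = 0")
    case False
    then have "1 \<le> \<bar>real_of_int q\<bar>" by linarith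
    then obtain k' where k': "\<bar>of_int q\<bar> \<le> T k'" "T k' \<le> R * \<bar>of_int q\<bar>" using scale_exists by auto
    let ?K = "2 * a\<^sub>1 * R"
    have K: "1 \<le> ?K" using a1_ge_1 R_ge_2 mult_mono[of 1 a\<^sub>1 2 R] by simp
    have "T k' * X ^ l \<le> R * \<bar>of_int q\<bar> * X ^ l" using k' VZ by (intro mult_right_mono) auto
    also have "\<dots> \<le> R * (2 * a\<^sub>1 * T k)" using q_le R_ge_2 unfolding mult.assoc by (intro mult_left_mono) auto
    finally have TZ: "T k' * X ^ l \<le> ?K * T k" by (simp add: mult_ac)
    have powr_le: "T k' powr s * (X ^ l) powr s \<le> ?K * T k powr s" if "0 < s" "s \<le> 1" for s
    proof -
      have "T k' powr s * (X ^ l) powr s = (T k' * X ^ l) powr s"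
        using T_pos[of k'] VZ by (simp add: powr_mult)
      also have "\<dots> \<le> (?K * T k) powr s" using TZ that T_pos[of k'] VZ by (intro powr_mono2) auto
      also have "\<dots> = ?K powr s * T k powr s" using K T_pos[of k] by (simp add: powr_mult)
      also have "\<dots> \<le> ?K powr 1 * T k powr s" using K that by (intro mult_right_mono powr_mono) auto
      finally show ?thesis using K by simp
    qed
    have "Ti k' * Y ^ l \<le> Ti k' * (X ^ l) powr i" using Z_powr T_pos[of k'] by simp
    also have "\<dots> \<le> ?K * Ti k" using powr_le[of i] i_bounds by (simp add: Ti_def)
    finally have TiV: "Ti k' * Y ^ l \<le> ?K * Ti k" .
    have "Tj k' * 1 \<le> Tj k' * (X ^ l) powr j" using Z_powr T_pos[of k'] by simp
    also have "\<dots> \<le> ?K * Tj k" using powr_le[of j] ij by (simp add: Tj_def)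
    finally have Tj': "Tj k' \<le> ?K * Tj k" by simp
    have "4 * a\<^sub>1 * \<kappa>\<^sub>1 * (Y ^ l / Ti k) \<le> 4 * a\<^sub>1 * \<kappa>\<^sub>1 * (?K / Ti k')"
      using TiV T_pos[of k] T_pos[of k'] \<kappa>_pos a1_ge_1
      by (intro mult_left_mono) (auto simp: field_simps)
    then have p_le': "\<bar>q * x - p\<bar> \<le> 8 * a\<^sub>1\<^sup>2 * R * \<kappa>\<^sub>1 / Ti k'"
      using p_le by (simp add: power2_eq_square mult_ac)
    have a2: "a\<^sub>1\<^sup>2 * (R * \<kappa>\<^sub>1) \<le> a\<^sub>1 ^ 3 * (R * \<kappa>\<^sub>1)"
      using a1_ge_1 R_ge_2 \<kappa>_pos by (intro mult_right_mono power_increasing) auto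
    have "0 < a\<^sub>1\<^sup>2 * (R * \<kappa>\<^sub>1)" using a1_ge_1 R_ge_2 \<kappa>_pos by simp
    then have "8 * a\<^sub>1\<^sup>2 * R * \<kappa>\<^sub>1 < \<kappa>\<^sub>2" using a2 \<kappa>1_\<kappa>2 by (simp add: mult.assoc)
    then have "8 * a\<^sub>1\<^sup>2 * R * \<kappa>\<^sub>1 / Ti k' < \<kappa>\<^sub>2 / Ti k'" using T_pos[of k'] by (simp add: divide_strict_right_mono)
    then have p_small: "\<bar>q * x - p\<bar> < \<kappa>\<^sub>2 / Ti k'" using p_le' by linarith
    define E where "E = a\<^sub>1 ^ 3 * R * \<kappa>\<^sub>1 / Tj k'"
    have "4 * a\<^sub>1\<^sup>2 * \<kappa>\<^sub>1 / Tj k \<le> 4 * a\<^sub>1\<^sup>2 * \<kappa>\<^sub>1 * (?K / Tj k')"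
      using Tj' T_pos[of k] T_pos[of k'] \<kappa>_pos a1_ge_1
        mult_left_mono[of "1 / Tj k" "?K / Tj k'" "4 * a\<^sub>1\<^sup>2 * \<kappa>\<^sub>1"] by (simp add: field_simps)
    moreover have "4 * a\<^sub>1\<^sup>2 * \<kappa>\<^sub>1 * (?K / Tj k') = 8 * E"
      by (simp add: E_def power2_eq_square power3_eq_cube)
    moreover have "a\<^sub>1 * (8 * a\<^sub>1\<^sup>2 * R * \<kappa>\<^sub>1 / Tj k') = 8 * E"
      by (simp add: E_def power2_eq_square power3_eq_cube)
    moreover have "a\<^sub>1 * \<bar>q * x - p\<bar> \<le> a\<^sub>1 * (8 * a\<^sub>1\<^sup>2 * R * \<kappa>\<^sub>1 / Tj k')"
    proof (rule mult_left_mono)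
      have "8 * a\<^sub>1\<^sup>2 * R * \<kappa>\<^sub>1 / Ti k' \<le> 8 * a\<^sub>1\<^sup>2 * R * \<kappa>\<^sub>1 / Tj k'"
        using Tj_le_Ti[of k'] T_pos[of k'] R_ge_2 \<kappa>_pos by (intro divide_left_mono) auto
      then show "\<bar>q * x - p\<bar> \<le> 8 * a\<^sub>1\<^sup>2 * R * \<kappa>\<^sub>1 / Tj k'" using p_le' by linarith
    qed (use a1_ge_1 in simp)
    ultimately have "\<bar>q * (a * x + b) - r\<bar> \<le> 16 * E" using r_le by linarith
    also have "\<dots> = 16 * a\<^sub>1 ^ 3 * R * \<kappa>\<^sub>1 / Tj k'" by (simp add: E_def)
    also have "\<dots> < \<kappa>\<^sub>2 / Tj k'" using \<kappa>1_\<kappa>2 T_pos[of k'] by (simp add: divide_strict_right_mono)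
    finally have "x \<in> point_obs k'" unfolding point_obs_def using False k' p_small by auto
    \<comment> \<open>Multiplying \<open>TZ\<close> by \<open>TiV\<close> turns the scales into
      powers of \<open>R\<close>, with \<open>X ^ l * Y ^ l = R ^ l\<close>; the constant
      \<open>?K\<^sup>2\<close> is absorbed by \<open>R ^ e\<close>.\<close>
    moreover have "k' + l \<le> k + e"
    proof -
      have "R ^ (k' + l) = (T k' * X ^ l) * (Ti k' * Y ^ l)"
        unfolding power_add VZ(4)[symmetric] T_Ti[of k', symmetric] by (simp add: mult_ac)
      also have "\<dots> \<le> (?K * T k) * (?K * Ti k)"
        using T_pos[of k'] T_pos[of k] Y K by (intro mult_mono[OF TZ TiV]) auto
      also have "\<dots> = ?K\<^sup>2 * R ^ k" by (simp add: power2_eq_square flip: T_Ti)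
      also have "\<dots> \<le> R ^ e * R ^ k"
      proof (intro mult_right_mono)
        have "a\<^sub>1\<^sup>2 * R\<^sup>2 \<le> a\<^sub>1 ^ 3 * R\<^sup>2" using a1_ge_1 by (intro mult_right_mono power_increasing) auto
        moreover have "0 \<le> a\<^sub>1\<^sup>2 * R\<^sup>2" by simp
        ultimately have "4 * (a\<^sub>1\<^sup>2 * R\<^sup>2) \<le> 16 * (a\<^sub>1 ^ 3 * R\<^sup>2)" by linarith
        moreover have "16 * (a\<^sub>1 ^ 3 * R\<^sup>2) \<le> R ^ e" using e by (simp add: a\<^sub>1_def R_def)
        ultimately show "?K\<^sup>2 \<le> R ^ e" by (simp add: power_mult_distrib)
      qed (use R_ge_2 in simp)
      finally have "R ^ (k' + l) \<le> R ^ (k + e)" by (simp add: power_add mult.commute)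
      then show ?thesis using R_ge_2 by (simp add: power_increasing_iff)
    qed
    ultimately show ?thesis by blast
  next
    case True
    \<comment> \<open>For parallel lines \<open>bound\<close> yields
      \<open>Y ^ l \<le> g * Ti k\<close>, which removes the growing factor from
      \<open>p_le\<close>. Then first \<open>p\<close> and afterwards \<open>r\<close> is an integer
      of absolute value below 1.\<close>
    define g where "g = a\<^sub>1 / c\<^sub>1"
    have g: "1 \<le> g" using a1_ge_1 c1 by (simp add: g_def)
    have "c\<^sub>1 * (Y ^ l) ^ 4 \<le> c\<^sub>1 * X ^ l" using VZ(3) c1 by simp
    then have "c\<^sub>1 * (Y ^ l) ^ 4 \<le> a\<^sub>1 * R ^ k" using bound by linarith
    then have "(Y ^ l) ^ 4 \<le> g * R ^ k" using c1 by (simp add: g_def field_simps)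
    also have "\<dots> = g * (Ti k * Ti k * Tj k)" by (simp flip: T_Ti Ti_Tj)
    also have "\<dots> \<le> g ^ 4 * Ti k ^ 4"
    proof (intro mult_mono)
      show "g \<le> g ^ 4" using g self_le_power[of g 4] by simp
      have "Ti k * Ti k * Tj k \<le> Ti k * Ti k * Ti k" using Tj_le_Ti T_pos[of k] by (intro mult_left_mono) auto
      also have "\<dots> = Ti k ^ 3" by (simp add: power3_eq_cube)
      also have "\<dots> \<le> Ti k ^ 4" using Ti_ge_1 by (intro power_increasing) auto
      finally show "Ti k * Ti k * Tj k \<le> Ti k ^ 4" .
    qed (use g T_pos[of k] in auto)
    finally have "(Y ^ l) ^ Suc 3 \<le> (g * Ti k) ^ Suc 3" by (simp add: power_mult_distrib)
    then have "Y ^ l \<le> g * Ti k" by (rule power_le_imp_le_base) (use g T_pos[of k] in simp)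
    then have "Y ^ l / Ti k \<le> g" using T_pos[of k] by (simp add: field_simps)
    then have "4 * a\<^sub>1 * \<kappa>\<^sub>1 * (Y ^ l / Ti k) \<le> 4 * a\<^sub>1 * \<kappa>\<^sub>1 * g"
      using \<kappa>_pos a1_ge_1 by (intro mult_left_mono) auto
    then have p1: "\<bar>q * x - p\<bar> \<le> 4 * a\<^sub>1 * \<kappa>\<^sub>1 * g" using p_le by linarith
    have small: "4 * a\<^sub>1\<^sup>2 * \<kappa>\<^sub>1 * g \<le> 1/4"
      using \<kappa>1_small c1 by (simp add: g_def field_simps power2_eq_square power3_eq_cube)
    have "1 * (4 * a\<^sub>1 * \<kappa>\<^sub>1 * g) \<le> a\<^sub>1 * (4 * a\<^sub>1 * \<kappa>\<^sub>1 * g)"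
      using a1_ge_1 \<kappa>_pos g by (intro mult_right_mono) auto
    also have "\<dots> = 4 * a\<^sub>1\<^sup>2 * \<kappa>\<^sub>1 * g" by (simp add: power2_eq_square)
    finally have "\<bar>q * x - p\<bar> < 1" using p1 small by linarith
    then have p0: "p = 0" using True by simp
    have "a\<^sub>1 * \<bar>q * x - p\<bar> = 0" using p0 True by simp
    moreover have "4 * a\<^sub>1\<^sup>2 * \<kappa>\<^sub>1 / Tj k \<le> 4 * a\<^sub>1\<^sup>2 * \<kappa>\<^sub>1 / 1"
      using Tj_ge_1[of k] \<kappa>_pos by (intro divide_left_mono) auto
    moreover have "4 * a\<^sub>1\<^sup>2 * \<kappa>\<^sub>1 * 1 \<le> 4 * a\<^sub>1\<^sup>2 * \<kappa>\<^sub>1 * g"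
      using g \<kappa>_pos by (intro mult_left_mono) auto
    ultimately have "\<bar>q * (a * x + b) - r\<bar> < 1" using r_le small by linarith
    then have r0: "r = 0" using True by simp
    have "?s * F A' B' C' z - ?s' * F A B C z = (q * (a * z + b) - r) - a * (q * z - p)" for z :: real
      by (simp add: q_def p_def r_def F_def algebra_simps)
    then show ?thesis using True p0 r0 by simp
  qed
qed

text \<open>Once the relevant points are avoided, \<open>two_lines\<close> leaves only lines
  proportional to a single one. They share its root \<open>w\<close>, and dividing the accuracy
  \<open>c / T k\<close> by the least slope of the class bounds the distance to
  \<open>w\<close>.\<close>

lemma line_obs_within_interval:
  fixes x y :: real
  assumes J: "{x..y} \<subseteq> {u..v}" "y - x = \<kappa>\<^sub>1 * R ^ l / R ^ k"
    and avoid: "\<And>k'. k' + l \<le> k + e \<Longrightarrow> point_obs k' \<inter> {x..y} = {}"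
  obtains p q where "line_obs k l \<inter> {x..y} \<subseteq> {p<..<q}" "q - p \<le> 2 * c * X ^ (l + 1) / R ^ k"
proof (cases "line_obs k l \<inter> {x..y} = {}")
  case True
  then show thesis using that[of 0 0] \<kappa>_pos X_gt_1 R_ge_2 by simp
next
  case False
  then obtain z where z: "z \<in> line_obs k l" "z \<in> {x..y}" by blast
  then obtain A B C :: int where L: "\<bar>of_int B\<bar> \<le> Tj k" "a\<^sub>1 * Ti k / X ^ (l + 1) < \<bar>A + a * B\<bar>"
      "\<bar>A + a * B\<bar> \<le> a\<^sub>1 * Ti k / X ^ l" "\<bar>F A B C z\<bar> < c / T k"
    unfolding line_obs_def by auto
  have slope_pos: "0 < a\<^sub>1 * Ti k / X ^ (l + 1)" using a1_ge_1 T_pos[of k] X_gt_1 by simp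
  define w where "w = z - F A B C z / (A + a * B)"
  have Fw: "F A B C w = 0"
    using F_diff[of A B C w z] slope_pos L(2) by (simp add: w_def)
  define h where "h = c * X ^ (l + 1) / R ^ k"
  \<comment> \<open>This allows both lines to be evaluated at the same \<open>z\<close>: across the
    interval a line of the class changes by at most its slope times the length, where
    \<open>X ^ l\<close> cancels and \<open>Y ^ l\<close> remains.\<close>
  have F_le: "\<bar>F A B C z\<bar> \<le> 2 * a\<^sub>1 * \<kappa>\<^sub>1 * Y ^ l / T k"
    if "\<bar>A + a * B\<bar> \<le> a\<^sub>1 * Ti k / X ^ l" "\<bar>F A B C z'\<bar> < c / T k" "z' \<in> {x..y}" for A B C :: int and z'
  proof -
    have "\<bar>F A B C z - F A B C z'\<bar> \<le> a\<^sub>1 * Ti k / X ^ l * (\<kappa>\<^sub>1 * R ^ l / R ^ k)"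
      unfolding F_diff abs_mult using that z J(2) slope_pos by (intro mult_mono) auto
    also have "\<dots> = a\<^sub>1 * \<kappa>\<^sub>1 * Y ^ l / T k"
      using T_pos[of k] X_gt_1 XY[symmetric] T_Ti[of k, symmetric] by (simp add: power_mult_distrib)
    finally have 1: "\<bar>F A B C z - F A B C z'\<bar> \<le> a\<^sub>1 * \<kappa>\<^sub>1 * Y ^ l / T k" .
    have "1 * c \<le> (a\<^sub>1 * Y ^ l) * \<kappa>\<^sub>1"
      using \<kappa>_mono \<kappa>_pos a1_ge_1 Y one_le_power[of Y l] mult_mono[of 1 a\<^sub>1 1 "Y ^ l"] by (intro mult_mono) auto
    then have "c / T k \<le> a\<^sub>1 * \<kappa>\<^sub>1 * Y ^ l / T k"
      using T_pos[of k] by (intro divide_right_mono) (auto simp: mult_ac)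
    moreover have "2 * a\<^sub>1 * \<kappa>\<^sub>1 * Y ^ l / T k = a\<^sub>1 * \<kappa>\<^sub>1 * Y ^ l / T k + a\<^sub>1 * \<kappa>\<^sub>1 * Y ^ l / T k" by simp
    ultimately show ?thesis using 1 that(2) by linarith
  qed
  have "line_obs k l \<inter> {x..y} \<subseteq> {w - h<..<w + h}"
  proof
    fix z' assume z': "z' \<in> line_obs k l \<inter> {x..y}"
    then obtain A' B' C' :: int where L': "\<bar>of_int B'\<bar> \<le> Tj k" "a\<^sub>1 * Ti k / X ^ (l + 1) < \<bar>A' + a * B'\<bar>"
        "\<bar>A' + a * B'\<bar> \<le> a\<^sub>1 * Ti k / X ^ l" "\<bar>F A' B' C' z'\<bar> < c / T k"
      unfolding line_obs_def by auto
    have bound: "c\<^sub>1 * X ^ l \<le> a\<^sub>1 * R ^ k" using line_class_bound z J(1) by blast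
    have "z' \<in> {x..y}" using z' by blast
    then have "(\<exists>k'. k' + l \<le> k + e \<and> z \<in> point_obs k') \<or>
         (\<forall>z. (A + a * B) * F A' B' C' z = (A' + a * B') * F A B C z)"
      by (intro two_lines[OF L(1) L'(1) L(3) L'(3) F_le[OF L(3,4) z(2)] F_le[OF L'(3,4)] bound])
    then have "(A + a * B) * F A' B' C' w = (A' + a * B') * F A B C w"
      using avoid z(2) by blast
    then have "F A' B' C' w = 0" using Fw L(2) slope_pos by auto
    then have "\<bar>A' + a * B'\<bar> * \<bar>z' - w\<bar> < c / T k"
      using F_diff[of A' B' C' z' w] L'(4) by (simp flip: abs_mult)
    moreover have "a\<^sub>1 * Ti k / X ^ (l + 1) * \<bar>z' - w\<bar> \<le> \<bar>A' + a * B'\<bar> * \<bar>z' - w\<bar>"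
      using L'(2) by (intro mult_right_mono) auto
    ultimately have "a\<^sub>1 * Ti k / X ^ (l + 1) * \<bar>z' - w\<bar> < c / T k" by linarith
    moreover have "1 * (Ti k / X ^ (l + 1) * \<bar>z' - w\<bar>) \<le> a\<^sub>1 * (Ti k / X ^ (l + 1) * \<bar>z' - w\<bar>)"
      using a1_ge_1 T_pos[of k] X_gt_1 by (intro mult_right_mono) auto
    ultimately have "Ti k / X ^ (l + 1) * \<bar>z' - w\<bar> < c / T k" by simp
    then have "\<bar>z' - w\<bar> < h"
      unfolding h_def using T_pos[of k] X_gt_1 by (simp add: field_simps flip: T_Ti)
    then show "z' \<in> {w - h<..<w + h}" by auto
  qed
  then show thesis by (rule that) (simp add: h_def mult_ac)
qed

text \<open>Two points with different abscissae would span a line of a scale smaller by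
  \<open>2 * D + e + 2\<close> that passes close to \<open>z\<close>, and such lines are avoided
  already. So all points of the class that matter have the same abscissa \<open>p / q\<close>,
  although the points themselves may differ.\<close>

lemma point_obs_within_interval:
  fixes x y :: real
  assumes J: "{x..y} \<subseteq> {u..v}" "y - x = \<kappa>\<^sub>3 / R ^ k"
    and avoid: "\<And>k' l. k' + (2 * D + e + 2) \<le> k \<Longrightarrow> line_obs k' l \<inter> {x..y} = {}"
  obtains p q where "point_obs k \<inter> {x..y} \<subseteq> {p<..<q}" "q - p \<le> 2 * R * \<kappa>\<^sub>2 / R ^ k"
proof (cases "point_obs k \<inter> {x..y} = {}")
  case True
  then show thesis using that[of 0 0] \<kappa>_pos R_ge_2 by simp
next
  case False
  let ?h = "2 * D + e + 2"
  obtain z where z: "z \<in> point_obs k" "z \<in> {x..y}" using False by blast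
  then obtain q p r :: int where P: "q \<noteq> 0" "\<bar>of_int q\<bar> \<le> T k"
      "\<bar>q * z - p\<bar> < \<kappa>\<^sub>2 / Ti k" "\<bar>q * (a * z + b) - r\<bar> < \<kappa>\<^sub>2 / Tj k"
    unfolding point_obs_def by auto
  define h where "h = R * \<kappa>\<^sub>2 / R ^ k"
  have "point_obs k \<inter> {x..y} \<subseteq> {p / q - h<..<p / q + h}"
  proof
    fix z' assume z': "z' \<in> point_obs k \<inter> {x..y}"
    then obtain q' p' r' :: int where P': "q' \<noteq> 0" "\<bar>of_int q'\<bar> \<le> T k" "T k \<le> R * \<bar>of_int q'\<bar>"
        "\<bar>q' * z' - p'\<bar> < \<kappa>\<^sub>2 / Ti k" "\<bar>q' * (a * z' + b) - r'\<bar> < \<kappa>\<^sub>2 / Tj k"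
      unfolding point_obs_def by auto
    let ?u = "q * z - p" and ?w = "q * (a * z + b) - r"
      and ?u' = "q' * z - p'" and ?w' = "q' * (a * z + b) - r'"
    have \<kappa>_le: "\<kappa>\<^sub>2 / Ti k \<le> \<kappa>\<^sub>3 / Ti k" "\<kappa>\<^sub>2 / Tj k \<le> \<kappa>\<^sub>3 / Tj k"
      using \<kappa>_mono T_pos[of k] by (auto intro!: divide_right_mono)
    have "\<bar>z - z'\<bar> \<le> \<kappa>\<^sub>3 / R ^ k" using z z' J(2) by auto
    then have "\<bar>q' * (z - z')\<bar> \<le> T k * (\<kappa>\<^sub>3 / R ^ k)"
      unfolding abs_mult using P'(2) T_pos[of k] by (intro mult_mono) auto
    also have "\<dots> = \<kappa>\<^sub>3 / Ti k" using T_pos[of k] by (simp flip: T_Ti)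
    finally have qz: "\<bar>q' * (z - z')\<bar> \<le> \<kappa>\<^sub>3 / Ti k" .
    have "?u' = (q' * z' - p') + q' * (z - z')" by (simp add: algebra_simps)
    then have u': "\<bar>?u'\<bar> \<le> 2 * \<kappa>\<^sub>3 / Ti k" using P'(4) qz \<kappa>_le by linarith
    have u: "\<bar>?u\<bar> \<le> 2 * \<kappa>\<^sub>3 / Ti k"
      using P(3) \<kappa>_le \<kappa>_pos T_pos[of k] by (simp add: divide_right_mono)
    have "\<bar>a * (q' * (z - z'))\<bar> \<le> \<bar>a\<bar> * (\<kappa>\<^sub>3 / Ti k)"
      unfolding abs_mult[of a] using qz by (intro mult_left_mono) auto
    also have "\<dots> \<le> \<bar>a\<bar> * (\<kappa>\<^sub>3 / Tj k)"
      using Tj_le_Ti[of k] T_pos[of k] \<kappa>_pos by (intro mult_left_mono divide_left_mono) auto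
    finally have aqz: "\<bar>a * (q' * (z - z'))\<bar> \<le> \<bar>a\<bar> * (\<kappa>\<^sub>3 / Tj k)" .
    have k3j: "0 \<le> \<kappa>\<^sub>3 / Tj k" "0 \<le> \<bar>a\<bar> * (\<kappa>\<^sub>3 / Tj k)" using \<kappa>_pos T_pos[of k] by auto
    have two: "2 * a\<^sub>1 * \<kappa>\<^sub>3 / Tj k = 2 * (\<kappa>\<^sub>3 / Tj k) + 2 * (\<bar>a\<bar> * (\<kappa>\<^sub>3 / Tj k))"
      by (simp add: a\<^sub>1_def add_divide_distrib algebra_simps)
    have "?w' = (q' * (a * z' + b) - r') + a * (q' * (z - z'))" by (simp add: algebra_simps)
    then have w': "\<bar>?w'\<bar> \<le> 2 * a\<^sub>1 * \<kappa>\<^sub>3 / Tj k" using P'(5) aqz \<kappa>_le two k3j by linarith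
    have w: "\<bar>?w\<bar> \<le> 2 * a\<^sub>1 * \<kappa>\<^sub>3 / Tj k" using P(4) \<kappa>_le two k3j by linarith
    \<comment> \<open>the line through the two rational points\<close>
    define A B C where "A = q' * r - q * r'" and "B = q * p' - q' * p" and "C = p * r' - p' * r"
    have A_eq: "A = q * ?w' - q' * ?w" and B_eq: "B = q' * ?u - q * ?u'"
      and F_eq: "F A B C z = ?u * ?w' - ?u' * ?w"
      by (simp_all add: A_def B_def C_def F_def algebra_simps)
    have "\<bar>real_of_int A\<bar> \<le> 2 * (T k * (2 * a\<^sub>1 * \<kappa>\<^sub>3 / Tj k))"
      unfolding A_eq by (intro abs_cross_diff_le P P' w w')
    also have "\<dots> = 4 * a\<^sub>1 * \<kappa>\<^sub>3 * Ti k" using T_pos[of k] by (simp flip: Ti_Tj)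
    finally have A_le: "\<bar>of_int A\<bar> \<le> 4 * a\<^sub>1 * \<kappa>\<^sub>3 * Ti k" .
    have "\<bar>real_of_int B\<bar> \<le> 2 * (T k * (2 * \<kappa>\<^sub>3 / Ti k))"
      unfolding B_eq by (intro abs_cross_diff_le P P' u u')
    also have "\<dots> = 1 * (4 * \<kappa>\<^sub>3 * Tj k)" using T_pos[of k] by (simp flip: Ti_Tj)
    also have "\<dots> \<le> a\<^sub>1 * (4 * \<kappa>\<^sub>3 * Tj k)"
      using a1_ge_1 \<kappa>_pos T_pos[of k] by (intro mult_right_mono) auto
    finally have B_le: "\<bar>of_int B\<bar> \<le> 4 * a\<^sub>1 * \<kappa>\<^sub>3 * Tj k" by (simp add: mult_ac)
    have "\<bar>F A B C z\<bar> \<le> 2 * (2 * \<kappa>\<^sub>3 / Ti k * (2 * a\<^sub>1 * \<kappa>\<^sub>3 / Tj k))"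
      unfolding F_eq by (intro abs_cross_diff_le u u' w w')
    also have "\<dots> = 8 * a\<^sub>1 * \<kappa>\<^sub>3 * \<kappa>\<^sub>3 / T k" by (simp flip: Ti_Tj)
    finally have F_le: "\<bar>F A B C z\<bar> \<le> 8 * a\<^sub>1 * \<kappa>\<^sub>3 * \<kappa>\<^sub>3 / T k" .
    have a3: "a\<^sub>1 \<le> a\<^sub>1 ^ 3" using self_le_power[OF a1_ge_1, of 3] by simp
    have small: "16 * a\<^sub>1 * \<kappa>\<^sub>3 * R ^ (2 * D + e + 4) \<le> 1"
    proof -
      have "a\<^sub>1 * (16 * \<kappa>\<^sub>3 * R ^ (2 * D + e + 4)) \<le> a\<^sub>1 ^ 3 * (16 * \<kappa>\<^sub>3 * R ^ (2 * D + e + 4))"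
        using a3 \<kappa>_pos R_ge_2 by (intro mult_right_mono) auto
      also have "\<dots> \<le> c\<^sub>1" using \<kappa>3_small by (simp add: mult_ac)
      finally show ?thesis using c1 by (simp add: mult_ac)
    qed
    have small': "4 * a\<^sub>1 * \<kappa>\<^sub>3 * R ^ ?h < 1"
    proof -
      have "4 * a\<^sub>1 * \<kappa>\<^sub>3 * R ^ ?h < 16 * a\<^sub>1 * \<kappa>\<^sub>3 * R ^ ?h" using a1_ge_1 \<kappa>_pos R_ge_2 by simp
      also have "\<dots> \<le> 16 * a\<^sub>1 * \<kappa>\<^sub>3 * R ^ (2 * D + e + 4)"
        using a1_ge_1 \<kappa>_pos R_ge_2 by (intro mult_left_mono power_increasing) auto
      finally show ?thesis using small by linarith
    qed
    \<comment> \<open>\<open>B\<close> vanishes exactly when the abscissae agree. For small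
      \<open>k\<close> it is an integer of absolute value below 1; for larger \<open>k\<close> the
      factor \<open>\<kappa>\<^sub>3\<close> in the height bounds pays for passing to the smaller
      scale \<open>k'\<close>.\<close>
    have "B = 0"
    proof (rule ccontr)
      assume "B \<noteq> 0"
      have "?h \<le> k"
      proof (rule ccontr)
        assume "\<not> ?h \<le> k"
        have "Tj k \<le> T k * Ti k" using Tj_le_Ti[of k] T_ge_1[of k] T_pos[of k] mult_mono[of 1 "T k" "Tj k" "Ti k"] by simp
        also have "\<dots> \<le> R ^ ?h" unfolding T_Ti using \<open>\<not> ?h \<le> k\<close> R_ge_2 by (intro power_increasing) auto
        finally have "4 * a\<^sub>1 * \<kappa>\<^sub>3 * Tj k \<le> 4 * a\<^sub>1 * \<kappa>\<^sub>3 * R ^ ?h"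
          using a1_ge_1 \<kappa>_pos by (intro mult_left_mono) auto
        then have "\<bar>real_of_int B\<bar> < 1" using B_le small' by linarith
        then show False using \<open>B \<noteq> 0\<close> by linarith
      qed
      then obtain k' where k': "k = k' + ?h" by (metis le_Suc_ex add.commute)
      have le_T: "4 * a\<^sub>1 * \<kappa>\<^sub>3 * s \<le> t" if "s \<le> R ^ ?h * t" "0 < t" for s t
      proof -
        have "4 * a\<^sub>1 * \<kappa>\<^sub>3 * s \<le> 4 * a\<^sub>1 * \<kappa>\<^sub>3 * (R ^ ?h * t)"
          using a1_ge_1 \<kappa>_pos that by (intro mult_left_mono) auto
        also have "\<dots> = (4 * a\<^sub>1 * \<kappa>\<^sub>3 * R ^ ?h) * t" by (simp only: mult.assoc)
        also have "\<dots> \<le> 1 * t" using small' that by (intro mult_right_mono) auto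
        finally show ?thesis by simp
      qed
      have A': "\<bar>of_int A\<bar> \<le> Ti k'"
        using A_le le_T[OF T_add_le(1)[of k' ?h, folded k'] T_pos(2)] by linarith
      have B': "\<bar>of_int B\<bar> \<le> Tj k'"
        using B_le le_T[OF T_add_le(2)[of k' ?h, folded k'] T_pos(3)] by linarith
      \<comment> \<open>The value of the form is quadratic in \<open>\<kappa>\<^sub>3\<close>,
        whereas \<open>c\<close> is \<open>\<kappa>\<^sub>3\<close> divided by a fixed power of
        \<open>R\<close>.\<close>
      have "8 * a\<^sub>1 * \<kappa>\<^sub>3 * \<kappa>\<^sub>3 < c"
      proof -
        have "8 * a\<^sub>1 * \<kappa>\<^sub>3 * R ^ (2 * D + e + 4) < 16 * a\<^sub>1 * \<kappa>\<^sub>3 * R ^ (2 * D + e + 4)"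
          using a1_ge_1 \<kappa>_pos R_ge_2 by simp
        then have "(8 * a\<^sub>1 * \<kappa>\<^sub>3 * R ^ (2 * D + e + 4)) * \<kappa>\<^sub>3 < 1 * \<kappa>\<^sub>3"
          using small \<kappa>_pos by (intro mult_strict_right_mono) auto
        moreover have "c * R ^ (2 * D + e + 4) = \<kappa>\<^sub>3"
          unfolding c_def \<kappa>\<^sub>1_def \<kappa>\<^sub>2_def using R_ge_2
          by (simp add: field_simps power_add power_mult power2_eq_square numeral_eq_Suc)
        ultimately have "(8 * a\<^sub>1 * \<kappa>\<^sub>3 * \<kappa>\<^sub>3) * R ^ (2 * D + e + 4) < c * R ^ (2 * D + e + 4)"
          by (simp add: mult_ac)
        then show ?thesis by (rule mult_right_less_imp_less) (use R_ge_2 in simp)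
      qed
      then have "8 * a\<^sub>1 * \<kappa>\<^sub>3 * \<kappa>\<^sub>3 / T k < c / T k" using T_pos[of k] by (simp add: divide_strict_right_mono)
      also have "\<dots> \<le> c / T k'" using T_add_le(3)[of k' ?h, folded k'] T_pos[of k'] T_pos[of k] \<kappa>_pos
        by (intro divide_left_mono) auto
      finally have F': "\<bar>F A B C z\<bar> < c / T k'" using F_le by linarith
      obtain l where "z \<in> line_obs k' l"
        using line_class_exists[of A B z k' C] \<open>B \<noteq> 0\<close> z(2) J(1) A' B' F' by blast
      then show False using avoid[of k' l] k' z(2) by auto
    qed
    then have "q * p' = q' * p" by (simp add: B_def)
    then have "real_of_int q * p' = real_of_int q' * p" by (metis of_int_mult)
    then have "p' = q' * (p / q)" using P(1) by (simp add: field_simps)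
    then have "\<bar>of_int q'\<bar> * \<bar>z' - p / q\<bar> < \<kappa>\<^sub>2 / Ti k"
      using P'(4) by (simp add: right_diff_distrib flip: abs_mult)
    moreover have "T k / R * \<bar>z' - p / q\<bar> \<le> \<bar>of_int q'\<bar> * \<bar>z' - p / q\<bar>"
      using P'(3) R_ge_2 by (intro mult_right_mono) (auto simp: field_simps)
    ultimately have "T k / R * \<bar>z' - p / q\<bar> < \<kappa>\<^sub>2 / Ti k" by linarith
    then have "\<bar>z' - p / q\<bar> < h"
      unfolding h_def using T_pos[of k] R_ge_2 by (simp add: field_simps flip: T_Ti)
    then show "z' \<in> {p / q - h<..<p / q + h}" unfolding greaterThanLessThan_iff by linarith
  qed
  then show thesis by (rule that) (simp add: h_def)
qed

section \<open>From avoided points to \<open>Bad\<close>\<close>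

lemma Bad_on_if_avoids_points:
  assumes "\<And>k. x \<notin> point_obs k"
  shows "x \<in> Bad_on (\<lambda>x. a * x + b) i j"
proof -
  \<comment> \<open>Taking roots turns \<open>\<kappa>\<^sub>2 / T k powr s\<close> into
    \<open>\<kappa>\<^sub>2 powr (1 / s) / T k\<close>; replacing \<open>T k\<close> by
    \<open>q\<close> costs \<open>R\<close>, and the 2 makes the inequality strict.\<close>
  define c' where "c' = min (\<kappa>\<^sub>2 powr (1 / i)) (\<kappa>\<^sub>2 powr (1 / j)) / (2 * R)"
  have c': "0 < c'" unfolding c'_def using \<kappa>_pos R_ge_2 by simp
  have root: "c' / q < dist_int t powr (1 / s)"
    if "\<kappa>\<^sub>2 / T k powr s \<le> dist_int t" "T k \<le> R * q" "0 < s" "1 \<le> q"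
      "c' \<le> \<kappa>\<^sub>2 powr (1 / s) / (2 * R)" for k q s t
  proof -
    have "c' / q \<le> \<kappa>\<^sub>2 powr (1 / s) / (2 * R) / q" using that by (intro divide_right_mono) auto
    also have "\<dots> < \<kappa>\<^sub>2 powr (1 / s) / (R * q)" using that \<kappa>_pos R_ge_2 by (simp add: field_simps)
    also have "\<dots> \<le> \<kappa>\<^sub>2 powr (1 / s) / T k"
      using that T_pos[of k] by (intro divide_left_mono) auto
    also have "\<dots> = (\<kappa>\<^sub>2 / T k powr s) powr (1 / s)"
      using that T_pos[of k] \<kappa>_pos by (simp add: powr_divide powr_powr)
    also have "\<dots> \<le> dist_int t powr (1 / s)"
      using that T_pos[of k] \<kappa>_pos by (intro powr_mono2) auto
    finally show ?thesis .
  qed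
  have "c' / q < max (dist_int (q * x) powr (1 / i)) (dist_int (q * (a * x + b)) powr (1 / j))"
    if "1 \<le> q" for q :: nat
  proof -
    have "1 \<le> real q" using that by simp
    then obtain k where k: "q \<le> T k" "T k \<le> R * q" by (rule scale_exists)
    obtain p where p: "dist_int (q * x) = \<bar>q * x - of_int p\<bar>" using dist_int_attained .
    obtain r where r: "dist_int (q * (a * x + b)) = \<bar>q * (a * x + b) - of_int r\<bar>" using dist_int_attained .
    have "\<not> (\<bar>q * x - of_int p\<bar> < \<kappa>\<^sub>2 / Ti k \<and> \<bar>q * (a * x + b) - of_int r\<bar> < \<kappa>\<^sub>2 / Tj k)"
    proof
      assume "\<bar>q * x - of_int p\<bar> < \<kappa>\<^sub>2 / Ti k \<and> \<bar>q * (a * x + b) - of_int r\<bar> < \<kappa>\<^sub>2 / Tj k"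
      then have "x \<in> point_obs k"
        unfolding point_obs_def using k that
        by (intro CollectI exI[of _ "int q"] exI[of _ p] exI[of _ r]) auto
      then show False using assms by blast
    qed
    then consider "\<kappa>\<^sub>2 / T k powr i \<le> dist_int (q * x)" | "\<kappa>\<^sub>2 / T k powr j \<le> dist_int (q * (a * x + b))"
      unfolding p r Ti_def Tj_def by force
    then show ?thesis
    proof cases
      case 1
      then have "c' / q < dist_int (q * x) powr (1 / i)"
        using k that i_bounds R_ge_2 by (intro root) (auto simp: c'_def divide_right_mono)
      then show ?thesis by simp
    next
      case 2
      then have "c' / q < dist_int (q * (a * x + b)) powr (1 / j)"
        using k that ij R_ge_2 by (intro root) (auto simp: c'_def divide_right_mono)
      then show ?thesis by simp
    qed
  qed
  then show ?thesis using c' unfolding Bad_on_def Bad_def by auto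
qed

text \<open>Both families fit into one schedule. Points of scale \<open>k\<close> appear in round
  \<open>k + m\<close>, and lines of class \<open>(k, l)\<close> in round
  \<open>k + n\<^sub>0 - l\<close>, as their intervals are longer by \<open>R ^ l\<close>. The delay
  \<open>l div N\<close> is affordable because \<open>R ^ (l div N) \<le> Y ^ l\<close>. Whenever
  one family relies on the other, the obstacles in question are due by the current round, so there
  is no circularity.\<close>

lemma strategy_from_start:
  assumes \<beta>: "0 < \<beta>" "\<beta> < 1" "R = 2 / \<beta>"
    and D: "1 \<le> D" "10 * ((1 + 3 * real N) * (2/3) ^ D) \<le> 1"
  shows "\<exists>\<sigma>. \<forall>B. B 0 = {u..v} \<longrightarrow>
     (\<forall>n. legal_upto \<beta> \<sigma> B n \<longrightarrow> legal_move (1/2) (B n) (reply \<sigma> B n)) \<and>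
     ((\<forall>n. legal_upto \<beta> \<sigma> B n) \<longrightarrow>
        (\<exists>x\<in>Bad_on (\<lambda>x. a * x + b) i j. (\<Inter>n. B n) = {x}))"
proof -
  define n\<^sub>0 where "n\<^sub>0 = m + D + 2 + e"
  define Ob where "Ob n \<kappa> = (case \<kappa> of 0 \<Rightarrow> if m \<le> n then point_obs (n - m) else {}
      | Suc l \<Rightarrow> if n\<^sub>0 \<le> n + l then line_obs (n + l - n\<^sub>0) l else {})" for n \<kappa>
  define d where "d \<kappa> = (case \<kappa> of 0 \<Rightarrow> D | Suc l \<Rightarrow> D + l div N)" for \<kappa>
  \<comment> \<open>By \<open>line_class_bound\<close>, with \<open>k = n + l - n\<^sub>0\<close>,
    only slope classes \<open>l\<close> below this bound can meet \<open>{u..v}\<close> in round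
    \<open>n\<close>.\<close>
  define g where "g n = Suc (N * G + (N - 2) * n)" for n
  have R0: "0 < R" "R \<noteq> 0" using R_ge_2 by auto
  have pow: "(v - u) * (\<beta>/2) ^ n = (v - u) / R ^ n" for n
    using \<beta> by (simp add: power_divide)
  show ?thesis
  proof (rule halving_strategy_from[OF \<beta>(1,2) uv, where g = g and d = d and Ob = Ob])
    show "1 \<le> d \<kappa>" for \<kappa> using D by (auto simp: d_def split: nat.split)
    show "(\<Sum>\<kappa>\<le>g n. 2 * (2/3) ^ d \<kappa>) \<le> (1/5 :: real)" for n
    proof -
      let ?M = "N * G + (N - 2) * n"
      have "(\<Sum>\<kappa>\<le>g n. (2/3) ^ d \<kappa> :: real) = (2/3) ^ D + (\<Sum>l\<le>?M. (2/3) ^ (D + l div N))"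
        unfolding g_def by (subst sum.atMost_Suc_shift) (simp add: d_def)
      also have "(\<Sum>l\<le>?M. (2/3) ^ (D + l div N) :: real) = (2/3) ^ D * (\<Sum>l\<le>?M. (2/3) ^ (l div N))"
        by (simp add: power_add sum_distrib_left)
      also have "\<dots> \<le> (2/3) ^ D * (3 * N)"
        using N by (intro mult_left_mono sum_power_div_le) auto
      finally have "(\<Sum>\<kappa>\<le>g n. (2/3) ^ d \<kappa> :: real) \<le> (1 + 3 * real N) * (2/3) ^ D"
        by (simp add: algebra_simps)
      then show ?thesis using D unfolding sum_distrib_left[symmetric] by linarith
    qed
    show "x \<in> Bad_on (\<lambda>x. a * x + b) i j"
      if "x \<in> {u..v}" "\<And>n \<kappa>. \<kappa> \<le> g n \<Longrightarrow> x \<notin> Ob n \<kappa>" for x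
    proof (rule Bad_on_if_avoids_points)
      show "x \<notin> point_obs k" for k using that(2)[of 0 "k + m"] by (simp add: Ob_def)
    qed
    fix n \<kappa> and x y :: real
    assume J: "{x..y} \<subseteq> {u..v}" "y - x = (v - u) * (\<beta>/2) ^ n"
      and avoid: "\<And>n' \<kappa>'. \<kappa>' \<le> g n' \<Longrightarrow> n' + d \<kappa>' \<le> n \<Longrightarrow> Ob n' \<kappa>' \<inter> {x..y} = {}"
    show "\<exists>p q. Ob n \<kappa> \<inter> {x..y} \<subseteq> {p<..<q} \<and> q - p \<le> (v - u) * (\<beta>/2) ^ (n + d \<kappa>)"
    proof (cases "Ob n \<kappa> = {}")
      case True
      then show ?thesis using uv \<beta> by (intro exI[of _ 0]) simp
    next
      case nonempty: False
      show ?thesis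
      proof (cases \<kappa>)
        case 0
        then obtain k where k: "n = k + m" "Ob n \<kappa> = point_obs k"
          using nonempty by (auto simp: Ob_def le_iff_add add.commute split: if_splits)
        have "y - x = \<kappa>\<^sub>3 / R ^ k" using J(2)[unfolded pow] by (simp add: k(1) \<kappa>\<^sub>3_def power_add mult.commute)
        then obtain p q where pq: "point_obs k \<inter> {x..y} \<subseteq> {p<..<q}" "q - p \<le> 2 * R * \<kappa>\<^sub>2 / R ^ k"
        proof (rule point_obs_within_interval[OF J(1)])
          fix k' l assume k': "k' + (2 * D + e + 2) \<le> k"
          show "line_obs k' l \<inter> {x..y} = {}"
          proof (rule ccontr)
            assume "\<not> ?thesis"
            then obtain z where z: "z \<in> line_obs k' l" "z \<in> {x..y}" by blast
            define M where "M = N - 2"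
            have NM: "N = M + 2" "3 \<le> M" using N by (auto simp: M_def)
            have l: "(M + 1) * l \<le> (M + 2) * G + M * k'"
              using line_class_bound(2)[OF z(1)] z(2) J(1) NM by auto
            \<comment> \<open>The starting round \<open>n'\<close> of the class must not be
              negative; this is what \<open>2 * G \<le> m\<close> ensures.\<close>
            have "l \<le> k' + n\<^sub>0"
            proof (rule ccontr)
              assume "\<not> l \<le> k' + n\<^sub>0"
              then have "k' + 2 * G + 1 \<le> l" using G(2) by (simp add: n\<^sub>0_def)
              then have "(M + 1) * (k' + 2 * G + 1) \<le> (M + 1) * l" by (rule mult_le_mono2)
              then show False using l by (simp add: algebra_simps)
            qed
            then obtain n' where n': "n' + l = k' + n\<^sub>0" by (metis le_iff_add add.commute)
            then have "Ob n' (Suc l) = line_obs k' l" by (simp add: Ob_def)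
            moreover have "Suc l \<le> g n'"
            proof -
              have "M * k' \<le> M * (n' + l)" using n' by (intro mult_le_mono2) (simp add: n\<^sub>0_def)
              then have "l \<le> (M + 2) * G + M * n'" using l by (simp add: algebra_simps)
              then show ?thesis unfolding g_def using NM by simp
            qed
            moreover have "n' + d (Suc l) \<le> n"
            proof -
              have "n' + l div N \<le> n' + l" by simp
              then show ?thesis using k' n' k(1) unfolding d_def n\<^sub>0_def by simp
            qed
            ultimately show False using avoid[of "Suc l" n'] z by blast
          qed
        qed
        have "2 * R * \<kappa>\<^sub>2 / R ^ k \<le> (v - u) / R ^ (n + d \<kappa>)"
        proof -
          have "2 * R * \<kappa>\<^sub>2 / R ^ k = (2 / R) * ((v - u) / R ^ (n + d \<kappa>))"
            using R0 by (simp add: \<kappa>\<^sub>2_def \<kappa>\<^sub>3_def k(1) d_def 0 power_add)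
          also have "\<dots> \<le> 1 * ((v - u) / R ^ (n + d \<kappa>))"
            using R_ge_2 uv by (intro mult_right_mono) auto
          finally show ?thesis by simp
        qed
        then show ?thesis using pq k(2) unfolding pow by (intro exI[of _ p] exI[of _ q]) auto
      next
        case (Suc l)
        then obtain k where k: "n + l = k + n\<^sub>0" "Ob n \<kappa> = line_obs k l"
          using nonempty by (auto simp: Ob_def le_iff_add add.commute split: if_splits)
        have \<kappa>1: "\<kappa>\<^sub>1 = (v - u) / R ^ n\<^sub>0"
          by (simp add: \<kappa>\<^sub>1_def \<kappa>\<^sub>2_def \<kappa>\<^sub>3_def n\<^sub>0_def power_add)
        have Rk: "R ^ n * R ^ l = R ^ k * R ^ n\<^sub>0" using k(1) by (simp flip: power_add)
        have "(v - u) / R ^ n = (v - u) * R ^ l / (R ^ n * R ^ l)" using R0 by simp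
        then have "y - x = \<kappa>\<^sub>1 * R ^ l / R ^ k"
          unfolding J(2)[unfolded pow] Rk \<kappa>1 by (simp add: mult.commute)
        then obtain p q where pq: "line_obs k l \<inter> {x..y} \<subseteq> {p<..<q}" "q - p \<le> 2 * c * X ^ (l + 1) / R ^ k"
        proof (rule line_obs_within_interval[OF J(1)])
          fix k' assume "k' + l \<le> k + e"
          then have "k' + m + d 0 \<le> n" using k(1) by (simp add: d_def n\<^sub>0_def)
          then show "point_obs k' \<inter> {x..y} = {}"
            using avoid[of 0 "k' + m"] by (simp add: Ob_def)
        qed
        have "2 * c * X ^ (l + 1) / R ^ k \<le> (v - u) / R ^ (n + d \<kappa>)"
        proof -
          let ?t = "l div N"
          have "N * ?t \<le> l" by simp
          then have "R ^ ?t \<le> Y ^ l"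
            unfolding R_def using Y by (simp add: power_increasing flip: power_mult)
          moreover have "X \<le> R" using XY X_gt_1 Y by (metis less_eq_real_def mult_le_cancel_left1 order.strict_trans zero_less_one not_less)
          ultimately have "X ^ l * X * R ^ ?t \<le> X ^ l * R * Y ^ l"
            using X_gt_1 R0 by (intro mult_mono) auto
          also have "\<dots> = R ^ l * R" using XY by (metis mult.assoc mult.commute power_mult_distrib)
          finally have "X ^ l * X * R ^ ?t \<le> R ^ l * R" .
          then have 1: "2 * (X ^ l * X * R ^ ?t) \<le> R * (R ^ l * R)"
            using X_gt_1 R0 by (intro mult_mono[OF R_ge_2]) auto
          have "2 * c * X ^ (l + 1) / R ^ k = (v - u) * (2 * (X ^ l * X * R ^ ?t)) / (R ^ k * R ^ n\<^sub>0 * R ^ (D + 2) * R ^ ?t)"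
            using R0 by (simp add: c_def \<kappa>1 field_simps)
          also have "\<dots> \<le> (v - u) * (R * (R ^ l * R)) / (R ^ k * R ^ n\<^sub>0 * R ^ (D + 2) * R ^ ?t)"
            using 1 uv R0 by (intro divide_right_mono mult_left_mono) auto
          also have "\<dots> = (v - u) / R ^ (n + d \<kappa>)"
            using R0 unfolding Rk[symmetric] by (simp add: d_def Suc power_add)
          finally show ?thesis .
        qed
        then show ?thesis using pq k(2) unfolding pow by (intro exI[of _ p] exI[of _ q]) auto
      qed
    qed
  qed
qed

end

section \<open>The Diophantine condition\<close>

text \<open>The constant may depend on \<open>M\<close> because the game stays in its first
  interval. The parameters are fixed in an order without circularity: \<open>N\<close> from
  \<open>\<delta>\<close>, \<open>D\<close> from \<open>N\<close>, then \<open>e\<close> and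
  \<open>G\<close>, and finally \<open>m\<close>.\<close>

lemma winning_half_if_slope_bound:
  fixes i j a b \<delta> :: real
  assumes ij: "0 < j" "j \<le> i" "i + j = 1" and \<delta>: "0 < \<delta>"
    and slope: "\<And>M::real. \<exists>c>0. \<forall>(A::int) (B::int) (C::int) (x::real) (T::real). (A \<noteq> 0 \<or> B \<noteq> 0) \<longrightarrow> \<bar>x\<bar> \<le> M \<longrightarrow>
        1 \<le> T \<longrightarrow> \<bar>of_int B\<bar> \<le> T powr j \<longrightarrow> \<bar>A * x + B * (a * x + b) + C\<bar> < c / T \<longrightarrow>
        c * T powr (\<delta> - 1) \<le> \<bar>A + a * B\<bar>"
  shows "winning (1/2) (Bad_on (\<lambda>x. a * x + b) i j)"
  unfolding winning_def
proof (intro allI impI winning2_if_each_start)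
  fix \<beta> u v :: real assume \<beta>: "0 < \<beta> \<and> \<beta> < 1" and uv: "u < v"
  define Q where "Q = 2 / \<beta>"
  have Q: "2 \<le> Q" "1 < Q" using \<beta> by (auto simp: Q_def field_simps)
  obtain c where c: "0 < c" and c_slope: "\<And>(A::int) (B::int) (C::int) (x::real) (T::real). A \<noteq> 0 \<or> B \<noteq> 0 \<Longrightarrow>
      \<bar>x\<bar> \<le> max \<bar>u\<bar> \<bar>v\<bar> \<Longrightarrow> 1 \<le> T \<Longrightarrow> \<bar>of_int B\<bar> \<le> T powr j \<Longrightarrow>
      \<bar>A * x + B * (a * x + b) + C\<bar> < c / T \<Longrightarrow> c * T powr (\<delta> - 1) \<le> \<bar>A + a * B\<bar>"
    using slope[of "max \<bar>u\<bar> \<bar>v\<bar>"] by blast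
  define c\<^sub>1 where "c\<^sub>1 = min c 1"
  have c1: "0 < c\<^sub>1" "c\<^sub>1 \<le> 1" "c\<^sub>1 \<le> c" using c by (auto simp: c\<^sub>1_def)
  define N where "N = max 5 (nat \<lceil>4 / \<delta>\<rceil>)"
  have "4 / \<delta> \<le> N" unfolding N_def by linarith
  then have N: "5 \<le> N" "4 \<le> \<delta> * N" using \<delta> by (auto simp: N_def field_simps)
  define Y where "Y = Q powr (1 / N)"
  have Y: "1 < Y" "Y ^ N = Q"
    using N Q by (auto simp: Y_def powr_powr gr_one_powr simp flip: powr_realpow)
  have "0 < 1 / (10 * (1 + 3 * real N))" by simp
  then obtain D\<^sub>0 where "(2/3) ^ D\<^sub>0 < 1 / (10 * (1 + 3 * real N))"
    using real_arch_pow_inv[of "1 / (10 * (1 + 3 * real N))" "2/3"] by auto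
  then have "10 * ((1 + 3 * real N) * (2/3) ^ D\<^sub>0) \<le> 1" by (simp add: field_simps)
  moreover define D where "D = Suc D\<^sub>0"
  moreover have "10 * ((1 + 3 * real N) * (2/3) ^ D) \<le> 10 * ((1 + 3 * real N) * (2/3) ^ D\<^sub>0)"
    unfolding D_def by (intro mult_left_mono power_decreasing) auto
  ultimately have D: "1 \<le> D" "10 * ((1 + 3 * real N) * (2/3) ^ D) \<le> 1" by auto
  obtain e where e: "16 * (1 + \<bar>a\<bar>) ^ 3 * Q\<^sup>2 < Q ^ e" using real_arch_pow[OF Q(2)] by blast
  obtain G where "(1 + \<bar>a\<bar>) / c\<^sub>1 < Q ^ G" using real_arch_pow[OF Q(2)] by blast
  then have G: "1 + \<bar>a\<bar> \<le> c\<^sub>1 * Q ^ G" using c1 by (simp add: field_simps)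
  let ?K = "(v - u) * (16 * (1 + \<bar>a\<bar>) ^ 3 * Q ^ (2 * D + e + 4))"
  obtain m\<^sub>0 where m0: "?K / c\<^sub>1 < Q ^ m\<^sub>0" using real_arch_pow[OF Q(2)] by blast
  define m where "m = max m\<^sub>0 (2 * G)"
  have "Q ^ m\<^sub>0 \<le> Q ^ m" using Q by (intro power_increasing) (auto simp: m_def)
  then have "?K / c\<^sub>1 \<le> Q ^ m" using m0 by linarith
  then have m: "?K \<le> c\<^sub>1 * Q ^ m" using c1 by (simp add: field_simps)
  have Y_pow: "Y ^ N = 2 / \<beta>" using Y(2) by (simp add: Q_def)
  interpret line_obstacles i j a b u v c\<^sub>1 \<delta> Y N D e m G
  proof (unfold_locales, unfold Y(2))
    show "2 * G \<le> m" by (simp add: m_def)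
    fix A B C :: int and x T :: real
    assume *: "A \<noteq> 0 \<or> B \<noteq> 0" "x \<in> {u..v}" "1 \<le> T" "\<bar>of_int B\<bar> \<le> T powr j"
      "\<bar>A * x + B * (a * x + b) + C\<bar> < c\<^sub>1 / T"
    have "c\<^sub>1 / T \<le> c / T" using c1 *(3) by (intro divide_right_mono) auto
    then have F: "\<bar>A * x + B * (a * x + b) + C\<bar> < c / T" using *(5) by linarith
    have "\<bar>x\<bar> \<le> max \<bar>u\<bar> \<bar>v\<bar>" using *(2) by auto
    then have "c * T powr (\<delta> - 1) \<le> \<bar>A + a * B\<bar>" by (rule c_slope[OF *(1) _ *(3,4) F])
    moreover have "c\<^sub>1 * T powr (\<delta> - 1) \<le> c * T powr (\<delta> - 1)" using c1 by (intro mult_right_mono) auto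
    ultimately show "c\<^sub>1 * T powr (\<delta> - 1) \<le> \<bar>A + a * B\<bar>" by linarith
  qed (use ij uv Y Q N c1 e m G in auto)
  show "\<exists>\<sigma>. \<forall>B. B 0 = {u..v} \<longrightarrow>
     (\<forall>n. legal_upto \<beta> \<sigma> B n \<longrightarrow> legal_move (1/2) (B n) (reply \<sigma> B n)) \<and>
     ((\<forall>n. legal_upto \<beta> \<sigma> B n) \<longrightarrow>
        (\<exists>x\<in>Bad_on (\<lambda>x. a * x + b) i j. (\<Inter>n. B n) = {x}))"
    using \<beta> D Y_pow by (intro strategy_from_start) (auto simp: R_def)
qed

text \<open>The liminf controls large \<open>q\<close> only. For the others the value cannot vanish:
  if \<open>q * a\<close> and \<open>q * b\<close> were integers, so would be their multiples by
  \<open>Q\<close>, against the bound at \<open>Q * q\<close>. A finite minimum then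
  suffices.\<close>

lemma liminf_pos_imp_uniform_bound:
  fixes a b s :: real
  assumes "liminf (\<lambda>q::nat. ereal (real q powr s *
      max (dist_int (real q * a)) (dist_int (real q * b)))) > 0"
  obtains c where "0 < c"
    "\<And>q::nat. 1 \<le> q \<Longrightarrow> c \<le> real q powr s * max (dist_int (real q * a)) (dist_int (real q * b))"
proof -
  define h where "h q = real q powr s * max (dist_int (real q * a)) (dist_int (real q * b))" for q :: nat
  obtain c\<^sub>0 where c0: "0 < c\<^sub>0" "ereal c\<^sub>0 < liminf (\<lambda>q. ereal (h q))"
    using ereal_dense2[OF assms] unfolding h_def by auto
  then have "eventually (\<lambda>q. ereal c\<^sub>0 < ereal (h q)) sequentially" by (intro less_LiminfD)
  then obtain Q where Q: "\<And>q. Q \<le> q \<Longrightarrow> c\<^sub>0 < h q" by (auto simp: eventually_sequentially)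
  have dist_int_nonneg: "0 \<le> dist_int t" for t by (simp add: dist_int_def infdist_nonneg)
  have dist_int_0: "dist_int t = 0 \<longleftrightarrow> t \<in> \<int>" for t
    using in_closed_iff_infdist_zero[of "\<int> :: real set" t] by (auto simp: dist_int_def)
  have h_pos: "0 < h q" if "1 \<le> q" for q
  proof (rule ccontr)
    assume "\<not> 0 < h q"
    then have "max (dist_int (q * a)) (dist_int (q * b)) \<le> 0"
      using that by (simp add: h_def zero_less_mult_iff not_less del: max.bounded_iff)
    then have "q * a \<in> \<int>" "q * b \<in> \<int>"
      using dist_int_nonneg[of "q * a"] dist_int_nonneg[of "q * b"] by (simp_all flip: dist_int_0)
    then have "of_nat Q * (q * a) \<in> \<int>" "of_nat Q * (q * b) \<in> \<int>" by (auto intro!: Ints_mult[OF Ints_of_nat])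
    then have "dist_int (real (Q * q) * a) = 0" "dist_int (real (Q * q) * b) = 0"
      by (simp_all add: dist_int_0 mult.assoc)
    then have "h (Q * q) = 0" by (simp add: h_def)
    then show False using Q[of "Q * q"] that c0 by simp
  qed
  define c where "c = Min (insert c\<^sub>0 (h ` {1..Q}))"
  have "0 < c" unfolding c_def using c0 h_pos by (subst Min_gr_iff) auto
  moreover have "c \<le> h q" if "1 \<le> q" for q
  proof (cases "q \<le> Q")
    case True
    then show ?thesis unfolding c_def using that by (intro Min_le) auto
  next
    case False
    have "c \<le> c\<^sub>0" unfolding c_def by (intro Min_le) auto
    then show ?thesis using Q[of q] False by linarith
  qed
  ultimately show thesis using that unfolding h_def by blast
qed

lemma dist_int_le: "dist_int t \<le> \<bar>t - of_int p\<bar>"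
  unfolding dist_int_def using infdist_le[of "of_int p" \<int> t] by (simp add: dist_real_def)

lemma dist_int_abs_le: "dist_int (\<bar>of_int B\<bar> * t) \<le> \<bar>of_int A + t * of_int B\<bar>"
proof (cases "0 \<le> B")
  case True
  then show ?thesis using dist_int_le[of "\<bar>of_int B\<bar> * t" "- A"] by (simp add: algebra_simps)
next
  case False
  then show ?thesis using dist_int_le[of "\<bar>of_int B\<bar> * t" A] by (simp add: abs_minus_commute algebra_simps)
qed

text \<open>The hypothesis is applied to \<open>q = \<bar>B\<bar>\<close>; the height bound
  \<open>\<bar>B\<bar> \<le> T powr j\<close> turns the exponent \<open>(1 - \<delta>) / j\<close>
  into \<open>T powr (1 - \<delta>)\<close>.\<close>

lemma max_dist_int_lower_bound:
  fixes B :: int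
  assumes "\<And>q::nat. 1 \<le> q \<Longrightarrow> c \<le> real q powr s * max (dist_int (real q * a)) (dist_int (real q * b))"
    and "B \<noteq> 0" "\<bar>of_int B\<bar> \<le> T powr j" "1 \<le> T" "0 < j" "s \<le> (1 - \<delta>) / j" "\<delta> \<le> 1"
    and "dist_int (\<bar>of_int B\<bar> * a) \<le> t" "dist_int (\<bar>of_int B\<bar> * b) \<le> t"
  shows "c * T powr (\<delta> - 1) \<le> t"
proof -
  have B1: "1 \<le> \<bar>real_of_int B\<bar>" using assms(2) by linarith
  have nat: "real (nat \<bar>B\<bar>) = \<bar>of_int B\<bar>" by simp
  have "0 \<le> dist_int (\<bar>of_int B\<bar> * a)" by (simp add: dist_int_def infdist_nonneg)
  then have t: "0 \<le> t" using assms(8) by linarith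
  have "c \<le> \<bar>of_int B\<bar> powr s * max (dist_int (\<bar>of_int B\<bar> * a)) (dist_int (\<bar>of_int B\<bar> * b))"
    using assms(1)[of "nat \<bar>B\<bar>"] assms(2) unfolding nat by simp
  also have "\<dots> \<le> \<bar>of_int B\<bar> powr s * t" using assms(8,9) by (intro mult_left_mono) auto
  also have "\<dots> \<le> T powr (1 - \<delta>) * t"
  proof (rule mult_right_mono[OF _ t])
    have "\<bar>of_int B\<bar> powr s \<le> \<bar>of_int B\<bar> powr ((1 - \<delta>) / j)" using B1 assms(6) by (intro powr_mono)
    also have "\<dots> \<le> (T powr j) powr ((1 - \<delta>) / j)" using assms by (intro powr_mono2) auto
    finally show "\<bar>of_int B\<bar> powr s \<le> T powr (1 - \<delta>)" using assms(5) by (simp add: powr_powr)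
  qed
  finally have "c * T powr (\<delta> - 1) \<le> T powr (1 - \<delta>) * t * T powr (\<delta> - 1)" by (intro mult_right_mono) auto
  also have "\<dots> = t * (T powr (1 - \<delta>) * T powr (\<delta> - 1))" by (simp only: mult_ac)
  also have "\<dots> = t" using assms(4) by (simp flip: powr_add)
  finally show ?thesis .
qed

text \<open>Subtracting \<open>x * (A + a * B)\<close> eliminates \<open>x\<close>: a small value
  together with a small slope brings \<open>b * B\<close> close to the integer
  \<open>- C\<close>.\<close>

lemma line_constant_le:
  fixes A B C :: int and a b x M :: real
  assumes "\<bar>x\<bar> \<le> M"
  shows "\<bar>of_int C + b * B\<bar> \<le> \<bar>A * x + B * (a * x + b) + C\<bar> + M * \<bar>A + a * B\<bar>"
proof -
  have "of_int C + b * B = (A * x + B * (a * x + b) + C) - x * (A + a * B)" by (simp add: algebra_simps)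
  moreover have "\<bar>x * (A + a * B)\<bar> \<le> M * \<bar>A + a * B\<bar>"
    unfolding abs_mult using assms by (intro mult_right_mono) auto
  ultimately show ?thesis by linarith
qed

theorem theorem6:
  fixes i j a b :: real and f :: "real \<Rightarrow> real"
  assumes "0 < j" and "j \<le> i" and "i < 1" and "i + j = 1"
    and "f = (\<lambda>x. a * x + b)"
  shows
    "((\<exists>\<epsilon>>0. liminf (\<lambda>q::nat. ereal (real q powr (1 / j - \<epsilon>) *
          max (dist_int (real q * a)) (dist_int (real q * b)))) > 0)
        \<longrightarrow> winning (1/2) (Bad_on f i j)) \<and>
     (a \<in> \<rat> \<and> liminf (\<lambda>q::nat. ereal (real q powr (1 / j) *
          max (dist_int (real q * a)) (dist_int (real q * b)))) > 0
        \<longrightarrow> winning (1/2) (Bad_on f i j))"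
proof (intro conjI impI)
  assume "\<exists>\<epsilon>>0. liminf (\<lambda>q::nat. ereal (real q powr (1 / j - \<epsilon>) *
          max (dist_int (real q * a)) (dist_int (real q * b)))) > 0"
  then obtain \<epsilon> where \<epsilon>: "0 < \<epsilon>" and pos: "liminf (\<lambda>q::nat. ereal (real q powr (1 / j - \<epsilon>) *
          max (dist_int (real q * a)) (dist_int (real q * b)))) > 0" by blast
  obtain c where c: "0 < c" "\<And>q::nat. 1 \<le> q \<Longrightarrow>
      c \<le> real q powr (1 / j - \<epsilon>) * max (dist_int (real q * a)) (dist_int (real q * b))"
    using liminf_pos_imp_uniform_bound[OF pos] by blast
  \<comment> \<open>With \<open>\<delta> = \<epsilon> * j\<close> the exponents
    \<open>1 / j - \<epsilon>\<close> and \<open>(1 - \<delta>) / j\<close> agree. The cap at 1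
    keeps \<open>T powr (\<delta> - 1)\<close> at most 1, as the case \<open>B = 0\<close>
    requires.\<close>
  define \<delta> where "\<delta> = min (\<epsilon> * j) 1"
  have \<delta>: "0 < \<delta>" "\<delta> \<le> 1" "\<delta> \<le> \<epsilon> * j" using \<epsilon> assms by (auto simp: \<delta>_def)
  have exponent: "1 / j - \<epsilon> \<le> (1 - \<delta>) / j" using \<delta>(3) assms(1) by (simp add: field_simps)
  show "winning (1/2) (Bad_on f i j)"
    unfolding assms(5)
  proof (rule winning_half_if_slope_bound[OF assms(1,2,4) \<delta>(1)])
    fix M :: real
    \<comment> \<open>The loss in \<open>line_constant_le\<close> is the factor
      \<open>1 + \<bar>M\<bar>\<close>; this choice makes
      \<open>c\<^sub>1 * (1 + \<bar>M\<bar>)\<close> strictly less than \<open>c\<close>.\<close>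
    define c\<^sub>1 where "c\<^sub>1 = min (c / (2 * (2 + \<bar>M\<bar>))) 1"
    have c1: "0 < c\<^sub>1" "c\<^sub>1 \<le> 1" using c by (auto simp: c\<^sub>1_def)
    have "c\<^sub>1 \<le> c / (2 * (2 + \<bar>M\<bar>))" by (simp add: c\<^sub>1_def)
    then have "c\<^sub>1 * (2 * (2 + \<bar>M\<bar>)) \<le> c" by (simp add: pos_le_divide_eq)
    moreover have "c\<^sub>1 * (2 * (2 + \<bar>M\<bar>)) = 2 * (c\<^sub>1 * (1 + \<bar>M\<bar>)) + 2 * c\<^sub>1" by (simp add: algebra_simps)
    moreover have "0 < c\<^sub>1 * (1 + \<bar>M\<bar>)" using c1 by simp
    ultimately have c1_less: "c\<^sub>1 * (1 + \<bar>M\<bar>) < c" using c1 by linarith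
    show "\<exists>c>0. \<forall>(A::int) (B::int) (C::int) (x::real) (T::real). (A \<noteq> 0 \<or> B \<noteq> 0) \<longrightarrow> \<bar>x\<bar> \<le> M \<longrightarrow>
        1 \<le> T \<longrightarrow> \<bar>of_int B\<bar> \<le> T powr j \<longrightarrow> \<bar>A * x + B * (a * x + b) + C\<bar> < c / T \<longrightarrow>
        c * T powr (\<delta> - 1) \<le> \<bar>A + a * B\<bar>"
    proof (intro exI[of _ c\<^sub>1] conjI allI impI c1(1))
      fix A B C :: int and x T :: real
      assume L: "A \<noteq> 0 \<or> B \<noteq> 0" "\<bar>x\<bar> \<le> M" "1 \<le> T" "\<bar>of_int B\<bar> \<le> T powr j"
        "\<bar>A * x + B * (a * x + b) + C\<bar> < c\<^sub>1 / T"
      have T: "1 / T \<le> T powr (\<delta> - 1)" "T powr (\<delta> - 1) \<le> 1"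
        using L(3) \<delta> powr_mono[of "-1" "\<delta> - 1" T] powr_mono[of "\<delta> - 1" 0 T]
        by (auto simp: powr_minus_divide)
      show "c\<^sub>1 * T powr (\<delta> - 1) \<le> \<bar>A + a * B\<bar>"
      proof (cases "B = 0")
        case True
        then have "1 \<le> \<bar>real_of_int A\<bar>" using L(1) by linarith
        moreover have "c\<^sub>1 * T powr (\<delta> - 1) \<le> 1 * 1" using c1 T by (intro mult_mono) auto
        ultimately show ?thesis using True by simp
      next
        case False
        show ?thesis
        proof (rule ccontr)
          assume "\<not> ?thesis"
          then have s: "\<bar>A + a * B\<bar> \<le> c\<^sub>1 * T powr (\<delta> - 1)" by simp
          let ?t = "c\<^sub>1 * (1 + \<bar>M\<bar>) * T powr (\<delta> - 1)"
          have "c\<^sub>1 * T powr (\<delta> - 1) * 1 \<le> c\<^sub>1 * T powr (\<delta> - 1) * (1 + \<bar>M\<bar>)"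
            using c1 by (intro mult_left_mono) auto
          then have "dist_int (\<bar>of_int B\<bar> * a) \<le> ?t"
            using dist_int_abs_le[of B a A] s by (simp add: mult_ac)
          moreover have "dist_int (\<bar>of_int B\<bar> * b) \<le> ?t"
          proof -
            have "c\<^sub>1 / T \<le> c\<^sub>1 * T powr (\<delta> - 1)"
              using mult_left_mono[OF T(1), of c\<^sub>1] c1 by simp
            moreover have "M * \<bar>A + a * B\<bar> \<le> \<bar>M\<bar> * (c\<^sub>1 * T powr (\<delta> - 1))"
              using s by (intro mult_mono) auto
            moreover have "?t = c\<^sub>1 * T powr (\<delta> - 1) + \<bar>M\<bar> * (c\<^sub>1 * T powr (\<delta> - 1))"
              by (simp add: algebra_simps)
            ultimately show ?thesis
              using dist_int_abs_le[of B b C] line_constant_le[OF L(2), of C b B A a] L(5) by linarith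
          qed
          ultimately have "c * T powr (\<delta> - 1) \<le> ?t"
            using max_dist_int_lower_bound[OF c(2) False L(4,3) assms(1) exponent \<delta>(2)] by blast
          then show False using c1_less L(3) by simp
        qed
      qed
    qed
  qed
next
  assume *: "a \<in> \<rat> \<and> liminf (\<lambda>q::nat. ereal (real q powr (1 / j) *
          max (dist_int (real q * a)) (dist_int (real q * b)))) > 0"
  obtain c where c: "0 < c" "\<And>q::nat. 1 \<le> q \<Longrightarrow>
      c \<le> real q powr (1 / j) * max (dist_int (real q * a)) (dist_int (real q * b))"
    using liminf_pos_imp_uniform_bound * by blast
  obtain n d :: int where d: "0 < d" "a = n / d" using * by (auto elim: Rats_cases')
  define c\<^sub>1 where "c\<^sub>1 = min (c / 2) (1 / d)"
  have c1: "0 < c\<^sub>1" "c\<^sub>1 < c" "c\<^sub>1 \<le> 1 / d" using c d by (auto simp: c\<^sub>1_def)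
  show "winning (1/2) (Bad_on f i j)"
    unfolding assms(5)
  proof (rule winning_half_if_slope_bound[OF assms(1,2,4), of 1])
    fix M :: real
    show "\<exists>c>0. \<forall>(A::int) (B::int) (C::int) (x::real) (T::real). (A \<noteq> 0 \<or> B \<noteq> 0) \<longrightarrow> \<bar>x\<bar> \<le> M \<longrightarrow>
        1 \<le> T \<longrightarrow> \<bar>of_int B\<bar> \<le> T powr j \<longrightarrow> \<bar>A * x + B * (a * x + b) + C\<bar> < c / T \<longrightarrow>
        c * T powr (1 - 1) \<le> \<bar>A + a * B\<bar>"
    proof (intro exI[of _ c\<^sub>1] conjI allI impI c1(1))
      fix A B C :: int and x T :: real
      assume L: "A \<noteq> 0 \<or> B \<noteq> 0" "\<bar>x\<bar> \<le> M" "1 \<le> T" "\<bar>of_int B\<bar> \<le> T powr j"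
        "\<bar>A * x + B * (a * x + b) + C\<bar> < c\<^sub>1 / T"
      have s_eq: "A + a * B = of_int (A * d + n * B) / d" using d by (simp add: field_simps)
      \<comment> \<open>For rational \<open>a\<close> a nonzero slope is at least
        \<open>1 / d\<close>, so the Diophantine condition enters only to exclude slope zero. There
        \<open>max_dist_int_lower_bound\<close> is used with its \<open>\<delta>\<close> equal to 0,
        which is why \<open>\<epsilon> = 0\<close> suffices.\<close>
      have "A * d + n * B \<noteq> 0"
      proof
        assume "A * d + n * B = 0"
        then have s: "A + a * B = 0" unfolding s_eq by simp
        have "B \<noteq> 0" using L(1) s by auto
        moreover have "dist_int (\<bar>of_int B\<bar> * a) \<le> c\<^sub>1 / T"
          using dist_int_abs_le[of B a A] s c1 L(3) by (simp add: order_trans[OF _ divide_nonneg_pos])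
        moreover have "dist_int (\<bar>of_int B\<bar> * b) \<le> c\<^sub>1 / T"
          using dist_int_abs_le[of B b C] line_constant_le[OF L(2), of C b B A a] L(5) s by simp
        ultimately have "c * T powr (0 - 1) \<le> c\<^sub>1 / T"
          using max_dist_int_lower_bound[OF c(2) _ L(4,3) assms(1), of 0] by simp
        then show False using c1 L(3) by (simp add: powr_minus_divide divide_le_cancel)
      qed
      then have "1 \<le> \<bar>real_of_int (A * d + n * B)\<bar>" by linarith
      then have "1 / d \<le> \<bar>A + a * B\<bar>" unfolding s_eq using d by (simp add: divide_right_mono)
      then show "c\<^sub>1 * T powr (1 - 1) \<le> \<bar>A + a * B\<bar>" using c1 L(3) by simp
    qed
  qed simp
qed

end
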